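(* Let $\gamma\in\mathbb{R}\setminus\{0\}$ with $|\gamma|\leq 1$, and let $H$ be the operator on $L^2(\mathbb{R})$ given by $$H=-\frac{1}{4}\frac{\partial^2}{\partial x^2}+x^2-\gamma\left(\frac{1}{2}+x\frac{\partial}{\partial x}\right)$$ on the domain $\mathcal{D}=\{\Psi\in L^2(\mathbb{R}):\ \Psi \text{ has weak first and second derivatives in } L^2(\mathbb{R}),\ x^2\Psi(x)\in L^2(\mathbb{R})\}$. Then $H$ is $m$-accretive.
   Context: $L^2(\mathbb{R})$ carries the inner product $\langle f,g\rangle=\int_{-\infty}^{\infty}f(x)\overline{g(x)}\,dx$. The numerical range of $H$ is $W(H)=\{\langle H\psi,\psi\rangle:\ \psi\in\mathcal{D},\ \|\psi\|=1\}$. An operator $H$ is called $m$-accretive if its numerical range is contained in the closed right half-plane $\{z\in\mathbb{C}:\Re z\geq 0\}$ and the resolvent bound holds: for every $\lambda\in\mathbb{C}$ with $\Re\lambda<0$, the operator $H-\lambda$ has a bounded inverse with $\|(H-\lambda)^{-1}\|\leq 1/|\Re\lambda|$. *)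

theory Defs
  imports "HOL-Analysis.Analysis"
begin

text \<open>Functions in L^2(R) are represented by complex-valued functions on the reals
  (equality in L^2 is equality almost everywhere).\<close>

definition L2 :: "(real \<Rightarrow> complex) \<Rightarrow> bool" where
  "L2 f \<longleftrightarrow> f \<in> borel_measurable lborel \<and> integrable lborel (\<lambda>x. (cmod (f x))\<^sup>2)"

definition l2_inner :: "(real \<Rightarrow> complex) \<Rightarrow> (real \<Rightarrow> complex) \<Rightarrow> complex" where
  "l2_inner f g = (LINT x|lborel. f x * cnj (g x))"

definition l2_norm :: "(real \<Rightarrow> complex) \<Rightarrow> real" where
  "l2_norm f = sqrt (LINT x|lborel. (cmod (f x))\<^sup>2)"

text \<open>Test functions: smooth, compactly supported (real-valued; complex test
  functions are handled by linearity).\<close>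

definition test_fun :: "(real \<Rightarrow> real) \<Rightarrow> bool" where
  "test_fun \<phi> \<longleftrightarrow> (\<forall>n x. ((deriv ^^ n) \<phi>) differentiable (at x))
                    \<and> (\<exists>R. \<forall>x. R < \<bar>x\<bar> \<longrightarrow> \<phi> x = 0)"

definition weak_deriv1 :: "(real \<Rightarrow> complex) \<Rightarrow> (real \<Rightarrow> complex) \<Rightarrow> bool" where
  "weak_deriv1 f g \<longleftrightarrow> (\<forall>\<phi>. test_fun \<phi> \<longrightarrow>
      (LINT x|lborel. f x * complex_of_real (deriv \<phi> x))
        = - (LINT x|lborel. g x * complex_of_real (\<phi> x)))"

definition weak_deriv2 :: "(real \<Rightarrow> complex) \<Rightarrow> (real \<Rightarrow> complex) \<Rightarrow> bool" where
  "weak_deriv2 f g \<longleftrightarrow> (\<forall>\<phi>. test_fun \<phi> \<longrightarrow>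
      (LINT x|lborel. f x * complex_of_real ((deriv ^^ 2) \<phi> x))
        = (LINT x|lborel. g x * complex_of_real (\<phi> x)))"

definition dom_D :: "(real \<Rightarrow> complex) set" where
  "dom_D = {\<psi>. L2 \<psi> \<and> (\<exists>\<psi>1 \<psi>2. L2 \<psi>1 \<and> L2 \<psi>2 \<and> weak_deriv1 \<psi> \<psi>1 \<and> weak_deriv2 \<psi> \<psi>2)
                 \<and> L2 (\<lambda>x. complex_of_real (x\<^sup>2) * \<psi> x)}"

text \<open>Graph of the operator
  H = -1/4 d^2/dx^2 + x^2 - gamma (1/2 + x d/dx) on D:
  H_op gamma psi h means psi in D and h is (a representative of) H psi.\<close>
definition H_op :: "real \<Rightarrow> (real \<Rightarrow> complex) \<Rightarrow> (real \<Rightarrow> complex) \<Rightarrow> bool" where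
  "H_op \<gamma> \<psi> h \<longleftrightarrow> \<psi> \<in> dom_D \<and>
     (\<exists>\<psi>1 \<psi>2. L2 \<psi>1 \<and> L2 \<psi>2 \<and> weak_deriv1 \<psi> \<psi>1 \<and> weak_deriv2 \<psi> \<psi>2 \<and>
        h = (\<lambda>x. - (1/4) * \<psi>2 x + complex_of_real (x\<^sup>2) * \<psi> x
                 - complex_of_real \<gamma> * (\<psi> x / 2 + complex_of_real x * \<psi>1 x)))"

text \<open>m-accretivity of an operator given by its graph A (A psi h: psi in the domain,
  h represents A psi). Numerical range in the closed right half-plane, and for every
  lambda with Re lambda < 0, A - lambda has an inverse defined on all of L^2
  (surjective and injective, modulo a.e. equality) with norm at most 1/|Re lambda|.\<close>
definition m_accretive :: "((real \<Rightarrow> complex) \<Rightarrow> (real \<Rightarrow> complex) \<Rightarrow> bool) \<Rightarrow> bool" where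
  "m_accretive A \<longleftrightarrow>
     (\<forall>\<psi> h. A \<psi> h \<and> l2_norm \<psi> = 1 \<longrightarrow> Re (l2_inner h \<psi>) \<ge> 0) \<and>
     (\<forall>z::complex. Re z < 0 \<longrightarrow>
        (\<forall>\<psi> h. A \<psi> h \<and> (AE x in lborel. h x - z * \<psi> x = 0) \<longrightarrow> (AE x in lborel. \<psi> x = 0)) \<and>
        (\<forall>f. L2 f \<longrightarrow>
           (\<exists>\<psi> h. A \<psi> h \<and> (AE x in lborel. h x - z * \<psi> x = f x)) \<and>
           (\<forall>\<psi> h. A \<psi> h \<and> (AE x in lborel. h x - z * \<psi> x = f x)
                 \<longrightarrow> l2_norm \<psi> \<le> l2_norm f / \<bar>Re z\<bar>)))"

end

theory Submission
  imports Defs "HOL-Probability.Distributions" "HOL-Real_Asymp.Real_Asymp"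
begin

text \<open>With \<open>\<omega> = sqrt (1 + \<gamma>\<^sup>2)\<close> and \<open>c = \<gamma> + \<omega>\<close>, conjugating \<open>H\<close> by \<open>exp (- c x\<^sup>2)\<close> yields an operator
  that is triangular on polynomials with diagonal \<open>\<omega> (n + 1/2)\<close>. So for \<open>Re z < 0\<close> the operator \<open>H - z\<close>
  maps the functions \<open>p(x) exp (- c x\<^sup>2)\<close> onto themselves, and these are dense in \<open>L\<^sup>2\<close>. On them,
  integration by parts gives
  \<open>Re \<langle>H u, u\<rangle> = \<parallel>u'\<parallel>\<^sup>2/4 + \<parallel>x u\<parallel>\<^sup>2\<close> and
  \<open>Re \<langle>H u, x\<^sup>2 u\<rangle> = \<parallel>x u'\<parallel>\<^sup>2/4 + \<parallel>x\<^sup>2 u\<parallel>\<^sup>2 + \<gamma> \<parallel>x u\<parallel>\<^sup>2 - \<parallel>u\<parallel>\<^sup>2/4\<close>,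
  so \<open>u'\<close>, \<open>u''\<close>, \<open>x u'\<close> and \<open>x\<^sup>2 u\<close> are controlled by \<open>(H - z) u\<close>, and completeness of \<open>L\<^sup>2\<close>
  makes \<open>H - z\<close> surjective from the domain. For \<open>\<gamma> = 0\<close> the operator is symmetric, and duality shows that
  every domain element is a graph-norm limit of functions \<open>p(x) exp (- x\<^sup>2)\<close>. This extends the
  accretivity estimate, and with it the resolvent bound, to the whole domain for all \<open>\<gamma>\<close>.\<close>

section \<open>Square-integrable functions\<close>


text \<open>The number \<open>c\<close> is the positive root of c^2 - 2 \<gamma> c - 1 = 0, the
  condition under which the x^2 terms cancel after conjugation. The obstacle is the domain: its
  definition demands nothing of x \<psi>', so for an arbitrary domain element neither H \<psi> in L2
  nor an integration by parts is at hand. With \<gamma> = 0 the expression contains no x \<psi>', so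
  its value is in L2 by the domain conditions alone, and control of x \<psi>' comes back from the
  approximation. The transfer to other \<gamma> works because convergence of the five sequences u,
  u', u'', x^2 u, x u' is a notion independent of \<gamma>. Hence two exponents occur:
  \<open>c\<close> for surjectivity at the given \<gamma>, and 1 for the approximation of domain
  elements. The first-order term is skew-symmetric, so it is invisible in the first energy identity;
  it couples to the weight x^2 in the second, where |\<gamma>| \<le> 1 enters the estimate.\<close>

lemma L2_measurable [measurable_dest]: "L2 f \<Longrightarrow> f \<in> borel_measurable borel"
  by (simp add: L2_def)

lemma L2_integrable: "L2 f \<Longrightarrow> integrable lborel (\<lambda>x. (cmod (f x))\<^sup>2)"
  by (simp add: L2_def)

lemma L2_bound:
  assumes "f \<in> borel_measurable borel" "integrable lborel w" "\<And>x. (cmod (f x))\<^sup>2 \<le> w x"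
  shows "L2 f"
proof -
  have [measurable]: "f \<in> borel_measurable borel" by fact
  have "integrable lborel (\<lambda>x. (cmod (f x))\<^sup>2)"
  proof (rule Bochner_Integration.integrable_bound[OF assms(2)])
    show "AE x in lborel. norm ((cmod (f x))\<^sup>2) \<le> norm (w x)"
      using assms(3) by (intro AE_I2) (metis abs_ge_self abs_of_nonneg order_trans real_norm_def zero_le_power2)
  qed simp
  then show ?thesis using assms(1) by (simp add: L2_def)
qed

lemma cmod_add_sq_le: "(cmod (a + b))\<^sup>2 \<le> 2 * (cmod a)\<^sup>2 + 2 * (cmod b)\<^sup>2"
proof -
  have "(cmod (a + b))\<^sup>2 \<le> (cmod a + cmod b)\<^sup>2"
    by (simp add: norm_triangle_ineq power_mono)
  also have "\<dots> \<le> 2 * (cmod a)\<^sup>2 + 2 * (cmod b)\<^sup>2"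
    using zero_le_power2[of "cmod a - cmod b"] by (simp add: power2_eq_square algebra_simps)
  finally show ?thesis .
qed

lemma L2_add:
  assumes "L2 f" "L2 g" shows "L2 (\<lambda>x. f x + g x)"
proof -
  note [measurable] = L2_measurable[OF assms(1)] L2_measurable[OF assms(2)]
  show ?thesis
    by (rule L2_bound[where w = "\<lambda>x. 2 * (cmod (f x))\<^sup>2 + 2 * (cmod (g x))\<^sup>2"])
      (use assms in \<open>auto intro!: cmod_add_sq_le L2_integrable Bochner_Integration.integrable_add integrable_mult_right\<close>)
qed

lemma L2_scale:
  assumes "L2 f" shows "L2 (\<lambda>x. c * f x)"
proof -
  note [measurable] = L2_measurable[OF assms(1)]
  show ?thesis
    by (rule L2_bound[where w = "\<lambda>x. (cmod c)\<^sup>2 * (cmod (f x))\<^sup>2"])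
      (use assms in \<open>auto simp: norm_mult power_mult_distrib intro: L2_integrable\<close>)
qed

lemma L2_diff: "L2 f \<Longrightarrow> L2 g \<Longrightarrow> L2 (\<lambda>x. f x - g x)"
  using L2_add[of f "\<lambda>x. -1 * g x"] L2_scale[of g "-1"] by simp

lemma L2_cnj: "L2 f \<Longrightarrow> L2 (\<lambda>x. cnj (f x))"
  by (auto simp: L2_def intro: borel_measurable_continuous_on[OF continuous_on_cnj[OF continuous_on_id]])

lemma L2_mult_integrable:
  assumes "L2 f" "L2 g" shows "integrable lborel (\<lambda>x. f x * g x)"
proof -
  note [measurable] = L2_measurable[OF assms(1)] L2_measurable[OF assms(2)]
  show ?thesis
  proof (rule Bochner_Integration.integrable_bound[where f = "\<lambda>x. (cmod (f x))\<^sup>2 + (cmod (g x))\<^sup>2"])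
    show "integrable lborel (\<lambda>x. (cmod (f x))\<^sup>2 + (cmod (g x))\<^sup>2)"
      using assms by (auto intro: L2_integrable)
    have "a * b \<le> a\<^sup>2 + b\<^sup>2" for a b :: real
      using sum_squares_bound[of a b] zero_le_power2[of a] zero_le_power2[of b] by linarith
    then show "AE x in lborel. norm (f x * g x) \<le> norm ((cmod (f x))\<^sup>2 + (cmod (g x))\<^sup>2)"
      by (auto simp: norm_mult)
  qed simp
qed

lemma L2_AE_cong:
  assumes "L2 f" "g \<in> borel_measurable borel" "AE x in lborel. f x = g x"
  shows "L2 g"
proof -
  note [measurable] = L2_measurable[OF assms(1)] assms(2)
  have "integrable lborel (\<lambda>x. (cmod (g x))\<^sup>2)"
    by (rule integrable_cong_AE_imp[OF L2_integrable[OF assms(1)]]) (use assms(3) in auto)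
  then show ?thesis using assms(2) by (simp add: L2_def)
qed

text \<open>Working with the square of the norm keeps most estimates linear: the triangle inequality
  becomes \<open>sqn_add_le\<close>, whose factors 2 are harmless for limits and rates.\<close>

definition sqn :: "(real \<Rightarrow> complex) \<Rightarrow> real"
  where "sqn f = (LINT x|lborel. (cmod (f x))\<^sup>2)"

lemma sqn_nonneg: "0 \<le> sqn f"
  by (simp add: sqn_def)

lemma sqn_eq_0_iff:
  assumes "L2 f" shows "sqn f = 0 \<longleftrightarrow> (AE x in lborel. f x = 0)"
  unfolding sqn_def
  by (subst integral_nonneg_eq_0_iff_AE) (use assms in \<open>auto intro: L2_integrable\<close>)

lemma sqn_AE_cong:
  assumes "f \<in> borel_measurable borel" "g \<in> borel_measurable borel" "AE x in lborel. f x = g x"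
  shows "sqn f = sqn g"
  unfolding sqn_def by (rule integral_cong_AE) (use assms in auto)

lemma sqn_scale: "sqn (\<lambda>x. c * f x) = (cmod c)\<^sup>2 * sqn f"
  by (simp add: sqn_def norm_mult power_mult_distrib)

lemma sqn_add_le:
  assumes "L2 f" "L2 g" shows "sqn (\<lambda>x. f x + g x) \<le> 2 * sqn f + 2 * sqn g"
proof -
  have "sqn (\<lambda>x. f x + g x) \<le> (LINT x|lborel. 2 * (cmod (f x))\<^sup>2 + 2 * (cmod (g x))\<^sup>2)"
    unfolding sqn_def
    by (rule integral_mono) (use assms in \<open>auto intro!: cmod_add_sq_le L2_integrable L2_add\<close>)
  also have "\<dots> = 2 * sqn f + 2 * sqn g"
    using assms by (simp add: sqn_def L2_integrable)
  finally show ?thesis .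
qed

lemma sqn_diff_le:
  assumes "L2 f" "L2 g" shows "sqn (\<lambda>x. f x - g x) \<le> 2 * sqn f + 2 * sqn g"
  using sqn_add_le[OF assms(1) L2_scale[OF assms(2), of "-1"]] sqn_scale[of "-1" g] by simp

text \<open>Reduces to the inequality for nonnegative extended integrals, applied to the moduli. The
  pairing is bilinear because weak derivatives and the duality argument are; the Hermitian form
  follows with \<open>L2_cnj\<close>.\<close>

lemma L2_Cauchy_Schwarz:
  assumes "L2 f" "L2 g"
  shows "cmod (LINT x|lborel. f x * g x) \<le> sqrt (sqn f) * sqrt (sqn g)"
proof -
  note [measurable] = L2_measurable[OF assms(1)] L2_measurable[OF assms(2)]
  have int: "integrable lborel (\<lambda>x. cmod (f x) * cmod (g x))"
    using integrable_norm[OF L2_mult_integrable[OF assms]] by (simp add: norm_mult)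
  define I where "I = (LINT x|lborel. cmod (f x) * cmod (g x))"
  have I0: "0 \<le> I" by (simp add: I_def)
  have "(\<integral>\<^sup>+x. ennreal (cmod (f x)) * ennreal (cmod (g x)) \<partial>lborel)\<^sup>2
      \<le> (\<integral>\<^sup>+x. ennreal (cmod (f x)) ^ 2 \<partial>lborel) * (\<integral>\<^sup>+x. ennreal (cmod (g x)) ^ 2 \<partial>lborel)"
    by (rule Cauchy_Schwarz_nn_integral) auto
  moreover have "(\<integral>\<^sup>+x. ennreal (cmod (f x)) * ennreal (cmod (g x)) \<partial>lborel) = ennreal I"
    unfolding I_def using int by (subst nn_integral_eq_integral[symmetric]) (auto simp: ennreal_mult)
  moreover have "(\<integral>\<^sup>+x. ennreal (cmod (f x)) ^ 2 \<partial>lborel) = ennreal (sqn f)"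
    unfolding sqn_def using L2_integrable[OF assms(1)]
    by (subst nn_integral_eq_integral[symmetric]) (auto simp: ennreal_power)
  moreover have "(\<integral>\<^sup>+x. ennreal (cmod (g x)) ^ 2 \<partial>lborel) = ennreal (sqn g)"
    unfolding sqn_def using L2_integrable[OF assms(2)]
    by (subst nn_integral_eq_integral[symmetric]) (auto simp: ennreal_power)
  ultimately have "ennreal (I\<^sup>2) \<le> ennreal (sqn f * sqn g)"
    using I0 by (simp add: ennreal_power ennreal_mult sqn_nonneg)
  then have "I\<^sup>2 \<le> sqn f * sqn g"
    by (simp add: ennreal_le_iff sqn_nonneg)
  then have "I \<le> sqrt (sqn f * sqn g)"
    by (rule real_le_rsqrt)
  moreover have "cmod (LINT x|lborel. f x * g x) \<le> I"
    unfolding I_def using integral_norm_bound[of lborel "\<lambda>x. f x * g x"] by (simp add: norm_mult)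
  ultimately show ?thesis by (simp add: real_sqrt_mult)
qed

section \<open>Convergence and completeness in L2\<close>

definition L2_lim :: "(nat \<Rightarrow> real \<Rightarrow> complex) \<Rightarrow> (real \<Rightarrow> complex) \<Rightarrow> bool"
  where "L2_lim F f \<longleftrightarrow> (\<forall>n. L2 (F n)) \<and> L2 f \<and> (\<lambda>n. sqn (\<lambda>x. F n x - f x)) \<longlonglongrightarrow> 0"

text \<open>FG - fg = (F - f)(G - g) + (F - f) g + f (G - g), and Cauchy--Schwarz bounds each
  summand. Through this lemma identities for Gaussian polynomials pass to limits.\<close>

lemma L2_lim_pairing:
  assumes "L2_lim F f" "L2_lim G g"
  shows "(\<lambda>n. LINT x|lborel. F n x * G n x) \<longlonglongrightarrow> (LINT x|lborel. f x * g x)"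
proof -
  note [simp] = L2_diff L2_mult_integrable
  from assms have L: "L2 (F n)" "L2 (G n)" "L2 f" "L2 g" for n by (auto simp: L2_lim_def)
  define a where "a = (\<lambda>n. sqrt (sqn (\<lambda>x. F n x - f x)))"
  define b where "b = (\<lambda>n. sqrt (sqn (\<lambda>x. G n x - g x)))"
  have a: "a \<longlonglongrightarrow> 0" and b: "b \<longlonglongrightarrow> 0"
    using assms tendsto_real_sqrt[of _ 0] by (auto simp: L2_lim_def a_def b_def)
  have eq: "(LINT x|lborel. F n x * G n x) - (LINT x|lborel. f x * g x)
     = (LINT x|lborel. (F n x - f x) * (G n x - g x)) + (LINT x|lborel. (F n x - f x) * g x)
       + (LINT x|lborel. f x * (G n x - g x))" (is "?l n = _") for n
    by (simp add: L flip: Bochner_Integration.integral_diff Bochner_Integration.integral_add)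
       (simp add: algebra_simps)
  have "cmod (?l n) \<le> a n * b n + a n * sqrt (sqn g) + sqrt (sqn f) * b n" for n
    unfolding eq a_def b_def
    by (intro order_trans[OF norm_triangle_ineq] add_mono L2_Cauchy_Schwarz) (simp_all add: L)
  moreover have "(\<lambda>n. a n * b n + a n * sqrt (sqn g) + sqrt (sqn f) * b n) \<longlonglongrightarrow> 0 * 0 + 0 * sqrt (sqn g) + sqrt (sqn f) * 0"
    by (intro tendsto_intros a b)
  ultimately have "?l \<longlonglongrightarrow> 0"
    using Lim_null_comparison[of ?l "\<lambda>n. a n * b n + a n * sqrt (sqn g) + sqrt (sqn f) * b n" sequentially] by simp
  then show ?thesis
    by (rule LIM_zero_cancel)
qed

lemma L2_lim_const: "L2 f \<Longrightarrow> L2_lim (\<lambda>n. f) f"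
  by (simp add: L2_lim_def sqn_def)

lemma L2_lim_add:
  assumes "L2_lim F f" "L2_lim G g" shows "L2_lim (\<lambda>n x. F n x + G n x) (\<lambda>x. f x + g x)"
proof -
  from assms have L: "L2 (F n)" "L2 (G n)" "L2 f" "L2 g" for n by (auto simp: L2_lim_def)
  have "sqn (\<lambda>x. (F n x + G n x) - (f x + g x)) \<le> 2 * sqn (\<lambda>x. F n x - f x) + 2 * sqn (\<lambda>x. G n x - g x)" for n
    using sqn_add_le[of "\<lambda>x. F n x - f x" "\<lambda>x. G n x - g x"] L by (simp add: L2_diff algebra_simps)
  moreover have "(\<lambda>n. 2 * sqn (\<lambda>x. F n x - f x) + 2 * sqn (\<lambda>x. G n x - g x)) \<longlonglongrightarrow> 2 * 0 + 2 * 0"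
    using assms by (intro tendsto_intros) (auto simp: L2_lim_def)
  ultimately have "(\<lambda>n. sqn (\<lambda>x. (F n x + G n x) - (f x + g x))) \<longlonglongrightarrow> 0"
    using tendsto_sandwich[of "\<lambda>_. 0" "\<lambda>n. sqn (\<lambda>x. (F n x + G n x) - (f x + g x))" sequentially
        "\<lambda>n. 2 * sqn (\<lambda>x. F n x - f x) + 2 * sqn (\<lambda>x. G n x - g x)" 0] by (simp add: sqn_nonneg)
  then show ?thesis using L by (simp add: L2_lim_def L2_add)
qed

lemma L2_lim_scale:
  assumes "L2_lim F f" shows "L2_lim (\<lambda>n x. c * F n x) (\<lambda>x. c * f x)"
proof -
  have "sqn (\<lambda>x. c * F n x - c * f x) = (cmod c)\<^sup>2 * sqn (\<lambda>x. F n x - f x)" for n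
    using sqn_scale[of c "\<lambda>x. F n x - f x"] by (simp add: algebra_simps)
  then show ?thesis
    using assms tendsto_mult_left[of "\<lambda>n. sqn (\<lambda>x. F n x - f x)" 0 sequentially "(cmod c)\<^sup>2"]
    by (auto simp: L2_lim_def L2_scale)
qed

lemma L2_lim_diff:
  assumes "L2_lim F f" "L2_lim G g" shows "L2_lim (\<lambda>n x. F n x - G n x) (\<lambda>x. f x - g x)"
  using L2_lim_add[OF assms(1) L2_lim_scale[OF assms(2), of "-1"]] by simp

lemma L2_lim_cnj: "L2_lim F f \<Longrightarrow> L2_lim (\<lambda>n x. cnj (F n x)) (\<lambda>x. cnj (f x))"
  by (simp add: L2_lim_def L2_cnj sqn_def flip: complex_cnj_diff)

lemma L2_lim_AE_cong:
  assumes "L2_lim F f" "g \<in> borel_measurable borel" "AE x in lborel. f x = g x"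
  shows "L2_lim F g"
proof -
  from assms(1) have L: "L2 (F n)" "L2 f" for n by (auto simp: L2_lim_def)
  note [measurable] = L2_measurable[OF L(1)] L2_measurable[OF L(2)] assms(2)
  have "sqn (\<lambda>x. F n x - f x) = sqn (\<lambda>x. F n x - g x)" for n
    by (rule sqn_AE_cong) (use assms(3) in auto)
  then have "(\<lambda>n. sqn (\<lambda>x. F n x - g x)) = (\<lambda>n. sqn (\<lambda>x. F n x - f x))"
    by (intro ext) (rule sym)
  moreover have "L2 g" by (rule L2_AE_cong[OF L(2) assms(2,3)])
  ultimately show ?thesis using assms(1) unfolding L2_lim_def by simp
qed

text \<open>The limit inherits the bound by |g|, so |F n - f|^2 is dominated by 4 |g|^2. It serves
  the density argument and the cutoffs.\<close>

lemma L2_dominated_lim: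
  assumes "\<And>n. F n \<in> borel_measurable borel" "f \<in> borel_measurable borel" "L2 g"
    and "\<And>n x. cmod (F n x) \<le> cmod (g x)" "AE x in lborel. (\<lambda>n. F n x) \<longlonglongrightarrow> f x"
  shows "L2_lim F f"
proof -
  note [measurable] = assms(1) assms(2) L2_measurable[OF assms(3)]
  have LF: "L2 (F n)" for n
    by (rule L2_bound[OF _ L2_integrable[OF assms(3)]]) (auto intro: assms power_mono)
  have fb: "AE x in lborel. cmod (f x) \<le> cmod (g x)"
    using assms(5)
  proof eventually_elim
    case (elim x)
    show ?case
      by (rule tendsto_upperbound[OF tendsto_norm[OF elim]]) (use assms(4) in auto)
  qed
  have Lf: "L2 f"
  proof -
    have "integrable lborel (\<lambda>x. (cmod (f x))\<^sup>2)"
      by (rule Bochner_Integration.integrable_bound[OF L2_integrable[OF assms(3)]])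
         (use fb in \<open>auto simp: power_mono\<close>)
    then show ?thesis by (simp add: L2_def)
  qed
  have "(\<lambda>n. LINT x|lborel. (cmod (F n x - f x))\<^sup>2) \<longlonglongrightarrow> (LINT x|(lborel :: real measure). (0::real))"
  proof (rule integral_dominated_convergence[where f = "\<lambda>x. 0::real" and w = "\<lambda>x. 4 * (cmod (g x))\<^sup>2"])
    show "integrable lborel (\<lambda>x. 4 * (cmod (g x))\<^sup>2)"
      using assms(3) by (auto intro: L2_integrable)
    show "AE x in lborel. (\<lambda>i. (cmod (F i x - f x))\<^sup>2) \<longlonglongrightarrow> 0"
      using assms(5)
    proof eventually_elim
      case (elim x)
      have "(\<lambda>i. (cmod (F i x - f x))\<^sup>2) \<longlonglongrightarrow> (cmod (f x - f x))\<^sup>2"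
        by (intro tendsto_intros elim)
      then show ?case by simp
    qed
    show "AE x in lborel. norm ((cmod (F i x - f x))\<^sup>2) \<le> 4 * (cmod (g x))\<^sup>2" for i
      using fb
    proof eventually_elim
      case (elim x)
      have "cmod (F i x - f x) \<le> 2 * cmod (g x)"
        using norm_triangle_ineq4[of "F i x" "f x"] assms(4)[of i x] elim by linarith
      then have "(cmod (F i x - f x))\<^sup>2 \<le> (2 * cmod (g x))\<^sup>2"
        by (rule power_mono) simp
      then show ?case by (simp add: power_mult_distrib)
    qed
  qed simp_all
  then show ?thesis using LF Lf by (simp add: L2_lim_def sqn_def)
qed

text \<open>Tonelli for a series of nonnegative functions: its integral is the finite sum of the
  squared norms, so the series is finite almost everywhere.\<close>

lemma summable_sqn_AE:
  assumes "\<And>n. L2 (F n)" "summable (\<lambda>n. sqn (F n))"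
  shows "AE x in lborel. summable (\<lambda>n. (cmod (F n x))\<^sup>2)"
    and "integrable lborel (\<lambda>x. \<Sum>n. (cmod (F n x))\<^sup>2)"
proof -
  note [measurable] = L2_measurable[OF assms(1)]
  have "(\<integral>\<^sup>+x. (\<Sum>n. ennreal ((cmod (F n x))\<^sup>2)) \<partial>lborel) = (\<Sum>n. \<integral>\<^sup>+x. ennreal ((cmod (F n x))\<^sup>2) \<partial>lborel)"
    by (rule nn_integral_suminf) simp
  also have "\<dots> = (\<Sum>n. ennreal (sqn (F n)))"
    unfolding sqn_def using assms(1) by (subst nn_integral_eq_integral) (auto intro: L2_integrable)
  also have "\<dots> \<noteq> \<infinity>"
    using assms(2) by (simp add: ennreal_suminf_neq_top sqn_nonneg)
  finally have "AE x in lborel. (\<Sum>n. ennreal ((cmod (F n x))\<^sup>2)) \<noteq> \<infinity>"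
    by (intro nn_integral_PInf_AE) auto
  then show ae: "AE x in lborel. summable (\<lambda>n. (cmod (F n x))\<^sup>2)"
    by eventually_elim (auto intro: summable_suminf_not_top)
  show "integrable lborel (\<lambda>x. \<Sum>n. (cmod (F n x))\<^sup>2)"
    by (rule integrable_suminf) (use assms ae in \<open>auto intro: L2_integrable simp: sqn_def\<close>)
qed

text \<open>The rate makes the squared norms summable, and the terms of an almost everywhere
  convergent series tend to 0. No subsequence has to be chosen.\<close>

lemma AE_null_sequence:
  assumes "\<And>n. L2 (F n)" "\<And>n. sqn (F n) \<le> K / 4 ^ n"
  shows "AE x in lborel. (\<lambda>n. F n x) \<longlonglongrightarrow> 0"
proof -
  have "summable (\<lambda>n. K * (1 / 4) ^ n)"
    by (intro summable_mult summable_geometric) simp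
  then have "summable (\<lambda>n. sqn (F n))"
    by (rule summable_comparison_test'[where N = 0]) (use assms(2) in \<open>simp add: sqn_nonneg power_divide\<close>)
  from summable_sqn_AE(1)[OF assms(1) this] show ?thesis
  proof eventually_elim
    case (elim x)
    have "(\<lambda>n. sqrt ((cmod (F n x))\<^sup>2)) \<longlonglongrightarrow> sqrt 0"
      by (intro tendsto_intros summable_LIMSEQ_zero elim)
    then show ?case by (simp add: tendsto_norm_zero_iff)
  qed
qed

text \<open>The weights \<open>2 ^ n\<close> leave room for Cauchy--Schwarz, which makes the tail of the increments
  square integrable with an explicit rate.\<close>

lemma geometric_tail_bound:
  fixes d :: "nat \<Rightarrow> complex"
  assumes "summable (\<lambda>n. 2 ^ n * (cmod (d n))\<^sup>2)"
  shows "summable d"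
    and "(cmod (\<Sum>n. d (n + m)))\<^sup>2 \<le> 2 / 2 ^ m * (\<Sum>n. 2 ^ n * (cmod (d n))\<^sup>2)"
proof -
  define K where "K = (\<Sum>n. 2 ^ n * (cmod (d n))\<^sup>2)"
  have fin: "(\<Sum>n<N. cmod (d (n + m))) \<le> sqrt (2 / 2 ^ m * K)" for N m
  proof -
    have "(\<Sum>n<N. cmod (d (n + m)))\<^sup>2 = (\<Sum>n<N. (1 / sqrt (2 ^ (n + m))) * (sqrt (2 ^ (n + m)) * cmod (d (n + m))))\<^sup>2"
      by simp
    also have "\<dots> \<le> (\<Sum>n<N. (1 / sqrt (2 ^ (n + m)))\<^sup>2) * (\<Sum>n<N. (sqrt (2 ^ (n + m)) * cmod (d (n + m)))\<^sup>2)"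
      by (rule Cauchy_Schwarz_ineq_sum)
    also have "\<dots> = ((\<Sum>n<N. (1 / 2) ^ n) / 2 ^ m) * (\<Sum>n<N. 2 ^ (n + m) * (cmod (d (n + m)))\<^sup>2)"
      by (simp add: power_mult_distrib power_divide sum_divide_distrib power_add)
    also have "\<dots> \<le> (2 / 2 ^ m) * K"
    proof (rule mult_mono)
      have "(\<Sum>n<N. (1 / 2 :: real) ^ n) \<le> (\<Sum>n. (1 / 2) ^ n)"
        by (rule sum_le_suminf) (auto intro: summable_geometric)
      then show "(\<Sum>n<N. (1 / 2 :: real) ^ n) / 2 ^ m \<le> 2 / 2 ^ m"
        by (simp add: suminf_geometric divide_right_mono)
      have "(\<Sum>n<N. 2 ^ (n + m) * (cmod (d (n + m)))\<^sup>2) = (\<Sum>n\<in>(\<lambda>n. n + m) ` {..<N}. 2 ^ n * (cmod (d n))\<^sup>2)"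
        by (simp add: sum.reindex)
      also have "\<dots> \<le> K"
        unfolding K_def by (rule sum_le_suminf[OF assms]) auto
      finally show "(\<Sum>n<N. 2 ^ (n + m) * (cmod (d (n + m)))\<^sup>2) \<le> K" .
    qed (auto intro: sum_nonneg)
    finally show ?thesis by (rule real_le_rsqrt)
  qed
  have sm: "summable (\<lambda>n. cmod (d (n + m)))" for m
    by (rule summableI_nonneg_bounded[OF _ fin]) simp
  from sm[of 0] show "summable d"
    by (simp add: summable_norm_cancel)
  have "cmod (\<Sum>n. d (n + m)) \<le> (\<Sum>n. cmod (d (n + m)))"
    by (rule summable_norm[OF sm])
  also have "\<dots> \<le> sqrt (2 / 2 ^ m * K)"
    by (rule suminf_le_const[OF sm fin])
  finally have "(cmod (\<Sum>n. d (n + m)))\<^sup>2 \<le> (sqrt (2 / 2 ^ m * K))\<^sup>2"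
    by (rule power_mono) simp
  moreover have "0 \<le> K" unfolding K_def by (rule suminf_nonneg[OF assms]) simp
  ultimately show "(cmod (\<Sum>n. d (n + m)))\<^sup>2 \<le> 2 / 2 ^ m * (\<Sum>n. 2 ^ n * (cmod (d n))\<^sup>2)"
    by (simp add: K_def[symmetric])
qed

text \<open>Riesz--Fischer for sequences with a geometric rate. The pointwise convergence of the
  whole sequence is part of the conclusion because the unbounded multiplications by x and x^2 are
  later identified pointwise.\<close>

lemma L2_complete:
  assumes L: "\<And>n. L2 (F n)" and step: "\<And>n. sqn (\<lambda>x. F (Suc n) x - F n x) \<le> K / 4 ^ n"
  obtains f where "L2_lim F f" "AE x in lborel. (\<lambda>n. F n x) \<longlonglongrightarrow> f x"
proof -
  note [measurable] = L2_measurable[OF L]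
  define d where "d = (\<lambda>n x. F (Suc n) x - F n x)"
  have Ld: "L2 (d n)" for n unfolding d_def by (intro L2_diff L)
  note [measurable] = L2_measurable[OF Ld]
  \<comment> \<open>The factor \<open>sqrt (2 ^ n)\<close> turns the rate 4^-n of the increments
    into 2^-n, which is still summable, and yields the weighted series required by
    \<open>geometric_tail_bound\<close>.\<close>
  define e where "e = (\<lambda>n x. complex_of_real (sqrt (2 ^ n)) * d n x)"
  have Le: "L2 (e n)" for n unfolding e_def by (intro L2_scale Ld)
  have e2: "(cmod (e n x))\<^sup>2 = 2 ^ n * (cmod (d n x))\<^sup>2" for n x
    by (simp add: e_def norm_mult power_mult_distrib)
  have "summable (\<lambda>n. K * (1 / 2) ^ n)"
    by (intro summable_mult summable_geometric) simp
  then have "summable (\<lambda>n. sqn (e n))"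
  proof (rule summable_comparison_test'[where N = 0])
    fix n
    have "sqn (e n) = 2 ^ n * sqn (d n)"
      unfolding e_def by (simp add: sqn_scale)
    also have "\<dots> \<le> 2 ^ n * (K / 4 ^ n)"
      using step[of n] by (intro mult_left_mono) (auto simp: d_def)
    also have "\<dots> = K * (1 / 2) ^ n"
      by (simp add: field_simps flip: power_mult_distrib)
    finally show "norm (sqn (e n)) \<le> K * (1 / 2) ^ n" by (simp add: sqn_nonneg)
  qed
  from summable_sqn_AE[OF Le this] have
    ae: "AE x in lborel. summable (\<lambda>n. 2 ^ n * (cmod (d n x))\<^sup>2)" and
    int: "integrable lborel (\<lambda>x. \<Sum>n. 2 ^ n * (cmod (d n x))\<^sup>2)"
    by (simp_all add: e2)
  define f where "f = (\<lambda>x. F 0 x + (\<Sum>n. d n x))"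
  have [measurable]: "f \<in> borel_measurable borel" unfolding f_def by measurable
  have Fsum: "F m x = F 0 x + (\<Sum>n<m. d n x)" for m x
    by (induction m) (auto simp: d_def)
  have conv: "AE x in lborel. (\<lambda>n. F n x) \<longlonglongrightarrow> f x"
    using ae
  proof eventually_elim
    case (elim x)
    from geometric_tail_bound(1)[OF elim] show ?case
      unfolding f_def by (subst Fsum) (intro tendsto_intros summable_LIMSEQ)
  qed
  have tail: "AE x in lborel. (cmod (F m x - f x))\<^sup>2 \<le> 2 / 2 ^ m * (\<Sum>n. 2 ^ n * (cmod (d n x))\<^sup>2)" for m
    using ae
  proof eventually_elim
    case (elim x)
    have "F m x - f x = - (\<Sum>n. d (n + m) x)"
      unfolding f_def using suminf_split_initial_segment[OF geometric_tail_bound(1)[OF elim], of m] Fsum[of m x]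
      by simp
    then show ?case using geometric_tail_bound(2)[OF elim, of m] by simp
  qed
  have intm: "integrable lborel (\<lambda>x. (cmod (F m x - f x))\<^sup>2)" for m
  proof (rule Bochner_Integration.integrable_bound[OF integrable_mult_right[OF int, of "2 / 2 ^ m"]])
    show "AE x in lborel. norm ((cmod (F m x - f x))\<^sup>2) \<le> norm (2 / 2 ^ m * (\<Sum>n. 2 ^ n * (cmod (d n x))\<^sup>2))"
      using tail[of m]
    proof eventually_elim
      case (elim x)
      from order_trans[OF this abs_ge_self] show ?case
        unfolding real_norm_def abs_of_nonneg[OF zero_le_power2] .
    qed
  qed simp
  have LFf: "L2 (\<lambda>x. F m x - f x)" for m
    using intm[of m] by (simp add: L2_def)
  have Lf: "L2 f"
    using L2_diff[OF L[of 0] LFf[of 0]] by simp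
  define J where "J = (LINT x|lborel. (\<Sum>n. 2 ^ n * (cmod (d n x))\<^sup>2))"
  have le: "sqn (\<lambda>x. F m x - f x) \<le> 2 / 2 ^ m * J" for m
    unfolding sqn_def J_def integral_mult_right_zero[symmetric]
    by (rule integral_mono_AE[OF intm _ tail]) (intro integrable_mult_right int)
  have "(\<lambda>m. 2 / 2 ^ m * J) \<longlonglongrightarrow> 0"
    using tendsto_mult_left[OF LIMSEQ_realpow_zero[of "1 / 2 :: real"], of "2 * J"] by (simp add: power_divide)
  then have "(\<lambda>m. sqn (\<lambda>x. F m x - f x)) \<longlonglongrightarrow> 0"
    by (rule Lim_null_comparison[rotated]) (use le sqn_nonneg in auto)
  then have "L2_lim F f" using L Lf by (simp add: L2_lim_def)
  then show ?thesis using conv by (rule that)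
qed

section \<open>Gaussian polynomials\<close>


text \<open>Fundamental theorem of calculus on [-n, n], then dominated convergence with |w| as
  majorant. The integrations by parts on the line are instances, with W the collected boundary
  terms.\<close>

lemma integral_vector_derivative_eq_0:
  fixes W w :: "real \<Rightarrow> 'a::euclidean_space"
  assumes "\<And>x. (W has_vector_derivative w x) (at x)" "continuous_on UNIV w" "integrable lborel w"
    and "(\<lambda>n. W (real n)) \<longlonglongrightarrow> 0" "(\<lambda>n. W (- real n)) \<longlonglongrightarrow> 0"
  shows "(LINT x|lborel. w x) = 0"
proof -
  have [measurable]: "w \<in> borel_measurable borel"
    using assms(2) by (rule borel_measurable_continuous_onI)
  have eq: "(LINT x|lborel. indicator {- real n..real n} x *\<^sub>R w x) = W (real n) - W (- real n)" for n
    by (rule integral_FTC_Icc)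
      (auto intro: has_vector_derivative_at_within assms(1) continuous_on_subset[OF assms(2)])
  have "(\<lambda>n. LINT x|lborel. indicator {- real n..real n} x *\<^sub>R w x) \<longlonglongrightarrow> (LINT x|lborel. w x)"
  proof (rule integral_dominated_convergence[where w = "\<lambda>x. norm (w x)"])
    show "AE x in lborel. (\<lambda>i. indicator {- real i..real i} x *\<^sub>R w x) \<longlonglongrightarrow> w x"
    proof (rule AE_I2)
      fix x :: real
      obtain N :: nat where "\<bar>x\<bar> \<le> real N" using real_arch_simple by blast
      then have "eventually (\<lambda>i. indicator {- real i..real i} x *\<^sub>R w x = w x) sequentially"
        by (intro eventually_sequentiallyI[of N]) (auto simp: indicator_def dest: of_nat_mono[where 'a = real])
      then show "(\<lambda>i. indicator {- real i..real i} x *\<^sub>R w x) \<longlonglongrightarrow> w x"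
        by (rule tendsto_eventually)
    qed
    show "AE x in lborel. norm (indicator {- real i..real i} x *\<^sub>R w x) \<le> norm (w x)" for i
      by (auto simp: indicator_def)
  qed (use assms(3) in auto)
  moreover have "(\<lambda>n. W (real n) - W (- real n)) \<longlonglongrightarrow> 0 - 0"
    by (intro tendsto_intros assms)
  ultimately show ?thesis
    unfolding eq using LIMSEQ_unique by fastforce
qed

definition gp :: "real \<Rightarrow> complex poly \<Rightarrow> real \<Rightarrow> complex"
  where "gp c p x = poly p (complex_of_real x) * complex_of_real (exp (- c * x\<^sup>2))"

text \<open>The derivative conjugated by the Gaussian, acting on the polynomial factor alone;
  \<open>gp_H\<close> is the corresponding conjugate of H. Analysis on Gaussian polynomials thereby
  becomes algebra of polynomials.\<close>

definition gp_D :: "real \<Rightarrow> complex poly \<Rightarrow> complex poly"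
  where "gp_D c p = pderiv p - smult (complex_of_real (2 * c)) (pCons 0 p)"

definition gp_H :: "real \<Rightarrow> real \<Rightarrow> complex poly \<Rightarrow> complex poly"
  where "gp_H \<gamma> c p = smult (- 1 / 4) (gp_D c (gp_D c p)) + pCons 0 (pCons 0 p)
    - smult (complex_of_real \<gamma>) (smult (1 / 2) p + pCons 0 (gp_D c p))"

lemma gp_add: "gp c (p + q) x = gp c p x + gp c q x"
  and gp_diff: "gp c (p - q) x = gp c p x - gp c q x"
  and gp_smult: "gp c (smult a p) x = a * gp c p x"
  and gp_pCons_0: "gp c (pCons 0 p) x = complex_of_real x * gp c p x"
  by (simp_all add: gp_def algebra_simps)

lemma gp_mult: "gp c p x * gp d q x = gp (c + d) (p * q) x"
proof -
  have "exp (- (c + d) * x\<^sup>2) = exp (- c * x\<^sup>2) * exp (- d * x\<^sup>2)"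
    by (simp add: exp_add[symmetric] algebra_simps)
  then show ?thesis by (simp add: gp_def mult_ac)
qed

lemma cnj_poly_of_real: "cnj (poly p (complex_of_real x)) = poly (map_poly cnj p) (complex_of_real x)"
  by (simp only: poly_cnj complex_cnj_complex_of_real)

lemma cnj_gp: "cnj (gp c p x) = gp c (map_poly cnj p) x"
  by (simp only: gp_def complex_cnj_mult cnj_poly_of_real complex_cnj_complex_of_real)

lemma gp_H_eq:
  "gp c (gp_H \<gamma> c p) x = - (1/4) * gp c (gp_D c (gp_D c p)) x + complex_of_real (x\<^sup>2) * gp c p x
     - complex_of_real \<gamma> * (gp c p x / 2 + complex_of_real x * gp c (gp_D c p) x)"
  by (simp add: gp_H_def gp_add gp_diff gp_smult gp_pCons_0 power2_eq_square algebra_simps)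

lemma gp_has_vector_derivative: "(gp c p has_vector_derivative gp c (gp_D c p) x) (at x)"
proof -
  have "((\<lambda>z. poly p z * exp (- of_real c * z\<^sup>2)) has_field_derivative
     (poly (pderiv p) (of_real x) - 2 * of_real c * of_real x * poly p (of_real x)) * exp (- of_real c * (complex_of_real x)\<^sup>2)) (at (of_real x))"
    by (rule derivative_eq_intros refl | simp)+ (simp add: algebra_simps)
  from has_vector_derivative_real_field[OF this]
  show ?thesis
    unfolding gp_def[abs_def] by (simp add: gp_D_def algebra_simps exp_of_real[symmetric])
qed

lemma continuous_on_gp: "continuous_on A (gp c p)"
  unfolding gp_def[abs_def] by (intro continuous_intros)

lemma gp_measurable [measurable]: "gp c p \<in> borel_measurable borel"
  by (rule borel_measurable_continuous_onI[OF continuous_on_gp])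

lemma integrable_gp:
  assumes "c > 0" shows "integrable lborel (gp c p)"
proof -
  \<comment> \<open>The standard deviation for which the normal density is a constant multiple of
    exp(-c x^2), so that the known moments of the normal distribution apply.\<close>
  define s where "s = sqrt (1 / (2 * c))"
  have s: "s > 0" "s\<^sup>2 = 1 / (2 * c)" using assms by (simp_all add: s_def)
  have mono: "integrable lborel (\<lambda>x. exp (- c * x\<^sup>2) * x ^ k)" for k
  proof -
    have "integrable lborel (\<lambda>x. sqrt (2 * pi * s\<^sup>2) * (normal_density 0 s x * (x - 0) ^ k))"
      by (intro integrable_mult_right integrable_normal_moment[OF s(1)])
    moreover have "sqrt (2 * pi * s\<^sup>2) * (normal_density 0 s x * (x - 0) ^ k) = exp (- c * x\<^sup>2) * x ^ k" for x
      using assms s by (simp add: normal_density_def field_simps)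
    ultimately show ?thesis by (simp only:)
  qed
  have "gp c p x = (\<Sum>i\<le>degree p. coeff p i * complex_of_real (exp (- c * x\<^sup>2) * x ^ i))" for x
    unfolding gp_def poly_altdef sum_distrib_right by (simp add: mult_ac)
  then have "gp c p = (\<lambda>x. \<Sum>i\<le>degree p. coeff p i * complex_of_real (exp (- c * x\<^sup>2) * x ^ i))"
    by (rule ext)
  moreover have "integrable lborel \<dots>"
    by (intro Bochner_Integration.integrable_sum integrable_mult_right integrable_of_real mono)
  ultimately show ?thesis by simp
qed

text \<open>|gp c p|^2 is itself a Gaussian polynomial, with exponent 2c and polynomial factor p
  times its conjugate, so \<open>integrable_gp\<close> applies to it.\<close>

lemma L2_gp: "c > 0 \<Longrightarrow> L2 (gp c p)"
proof -
  assume c: "c > 0"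
  have "complex_of_real ((cmod (gp c p x))\<^sup>2) = gp (c + c) (p * map_poly cnj p) x" for x
    unfolding complex_norm_square cnj_gp gp_mult ..
  then have "integrable lborel (\<lambda>x. complex_of_real ((cmod (gp c p x))\<^sup>2))"
    using integrable_gp[of "c + c"] c by simp
  from integrable_Re[OF this] show ?thesis by (simp add: L2_def)
qed

lemma gp_tendsto_0:
  assumes "c > 0"
  shows "(\<lambda>n. gp c p (real n)) \<longlonglongrightarrow> 0" "(\<lambda>n. gp c p (- real n)) \<longlonglongrightarrow> 0"
proof -
  have mono: "(\<lambda>n. real n ^ k * exp (- c * (real n)\<^sup>2)) \<longlonglongrightarrow> 0" for k
    using assms by real_asymp
  have *: "(\<lambda>n. gp c p (s * real n)) \<longlonglongrightarrow> 0" if "s\<^sup>2 = 1" for s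
  proof -
    have "(\<lambda>n. \<Sum>i\<le>degree p. coeff p i * complex_of_real (s ^ i * (real n ^ i * exp (- c * (real n)\<^sup>2))))
        \<longlonglongrightarrow> (\<Sum>i\<le>degree p. coeff p i * complex_of_real (s ^ i * 0))"
      by (intro tendsto_intros mono)
    moreover have "(\<Sum>i\<le>degree p. coeff p i * complex_of_real (s ^ i * (real n ^ i * exp (- c * (real n)\<^sup>2))))
        = gp c p (s * real n)" for n
      unfolding gp_def poly_altdef sum_distrib_right power_mult_distrib that
      by (simp add: power_mult_distrib mult_ac)
    ultimately show ?thesis by simp
  qed
  show "(\<lambda>n. gp c p (real n)) \<longlonglongrightarrow> 0" "(\<lambda>n. gp c p (- real n)) \<longlonglongrightarrow> 0"
    using *[of 1] *[of "-1"] by simp_all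
qed

text \<open>The condition on \<open>c\<close> cancels the quadratic potential, so that on polynomials \<open>H\<close> becomes
  \<open>- p''/4 + \<omega> x p' + \<omega>/2 p\<close> with \<open>\<omega> = c - \<gamma> > 0\<close>: triangular in the monomials, with diagonal
  entries \<open>\<omega> (n + 1/2)\<close>.\<close>

lemma gp_H_onto:
  assumes c: "c > 0" "c\<^sup>2 = 1 + 2 * c * \<gamma>" and z: "Re z < 0"
  shows "\<exists>p. gp_H \<gamma> c p - smult z p = q"
proof -
  define L where "L = (\<lambda>p. gp_H \<gamma> c p - smult z p)"
  define w where "w = c - \<gamma>"
  have w: "w > 0"
  proof -
    \<comment> \<open>This is 2 c^2 - 2 c \<gamma> with 2 c \<gamma> = c^2 - 1 inserted.\<close>
    have "c * (2 * w) = c\<^sup>2 + 1" using c(2) by (simp add: w_def power2_eq_square algebra_simps)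
    then have "c * (2 * w) > 0" by (simp add: add_nonneg_pos)
    then show ?thesis using c(1) by (simp add: zero_less_mult_iff)
  qed
  have c2: "of_real c * of_real c = (1 + 2 * of_real c * of_real \<gamma> :: complex)"
    using arg_cong[OF c(2), of complex_of_real] by (simp add: power2_eq_square)
  have L_eq: "L p = smult (- 1 / 4) (pderiv (pderiv p)) + smult (of_real w) (pCons 0 (pderiv p))
      + smult (of_real w / 2 - z) p" for p
  proof -
    have "poly (L p) y = poly (smult (- 1 / 4) (pderiv (pderiv p)) + smult (of_real w) (pCons 0 (pderiv p))
      + smult (of_real w / 2 - z) p) y" for y
    proof -
      define a b d where "a = poly p y" "b = poly (pderiv p) y" "d = poly (pderiv (pderiv p)) y"
      have "poly (L p) y = - 1 / 4 * (d - 2 * of_real c * (a + y * b) - 2 * of_real c * y * (b - 2 * of_real c * (y * a)))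
        + y * y * a - of_real \<gamma> * (a / 2 + y * (b - 2 * of_real c * (y * a))) - z * a"
        by (simp add: L_def gp_H_def gp_D_def pderiv_diff pderiv_smult pderiv_pCons a_b_d_def algebra_simps)
      also have "\<dots> = - d / 4 + of_real w * y * b + (of_real w / 2 - z) * a
          + y * y * a * (1 + 2 * of_real c * of_real \<gamma> - of_real c * of_real c)"
        by (simp add: w_def field_simps)
      also have "\<dots> = - d / 4 + of_real w * y * b + (of_real w / 2 - z) * a"
        using c2 by simp
      finally show ?thesis by (simp add: a_b_d_def algebra_simps)
    qed
    then show ?thesis by (simp add: poly_eq_poly_eq_iff[symmetric] fun_eq_iff)
  qed
  have add: "L (p + r) = L p + L r" and sm: "L (smult a p) = smult a (L p)" for p r a
    by (simp_all add: L_eq pderiv_add pderiv_smult smult_add_right smult_diff_right mult.commute)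
  have mono: "\<exists>p. L p = monom 1 n" for n
  proof (induction n rule: less_induct)
    case (less n)
    \<comment> \<open>The diagonal entry of H - z at x^n. Since Re z < 0 its real part is positive,
      so it can be inverted.\<close>
    define e where "e = of_real (w * (real n + 1 / 2)) - z"
    have "w * (real n + 1 / 2) > 0" using w by (intro mult_pos_pos) auto
    then have "Re e > 0" using z by (simp add: e_def)
    then have e0: "e \<noteq> 0" by auto
    have Lm: "L (monom 1 n) = smult e (monom 1 n) - smult (of_nat (n * (n - 1)) / 4) (monom 1 (n - 2))"
    proof -
      have d1: "pderiv (monom 1 n) = monom (of_nat n :: complex) (n - 1)"
        by (simp add: pderiv_monom)
      have d2: "pderiv (monom (of_nat n) (n - 1)) = monom (of_nat (n * (n - 1)) :: complex) (n - 2)"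
        by (simp add: pderiv_monom mult.commute numeral_2_eq_2)
      have d3: "pCons 0 (monom (of_nat n) (n - 1)) = monom (of_nat n :: complex) n"
        by (cases n) (simp_all add: monom_Suc)
      have e: "monom (of_real w * of_nat n) n + monom (of_real w / 2 - z) n = monom e n"
        by (simp add: add_monom e_def algebra_simps)
      show ?thesis
        unfolding L_eq d1 d2 d3 smult_monom mult_1_right e[symmetric]
        by (simp add: minus_monom add.commute del: of_nat_mult)
    qed
    \<comment> \<open>The truncated subtraction in n - 2 is harmless: for n < 2 the factor n (n - 1)
      vanishes and the preimage is 0. Otherwise the induction hypothesis supplies it.\<close>
    obtain r where r: "smult (of_nat (n * (n - 1)) / 4) (monom 1 (n - 2)) = L r"
    proof (cases "n < 2")
      case True
      then have "n * (n - 1) = 0" by auto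
      then have "smult (of_nat (n * (n - 1)) / 4) (monom 1 (n - 2)) = L (smult 0 0)"
        unfolding sm by simp
      then show ?thesis by (rule that)
    next
      case False
      then obtain r where "L r = monom 1 (n - 2)" using less[of "n - 2"] by auto
      then show ?thesis by (intro that[of "smult (of_nat (n * (n - 1)) / 4) r"]) (simp add: sm)
    qed
    have "L (smult (1 / e) (monom 1 n + r)) = smult (1 / e) (L (monom 1 n) + L r)"
      by (simp only: sm add)
    also have "\<dots> = monom 1 n"
      unfolding Lm r[symmetric] diff_add_cancel using e0 by (simp add: smult_monom)
    finally show ?case by blast
  qed
  have sum: "\<exists>p. L p = (\<Sum>i\<le>n. monom (a i) i)" for n :: nat and a
  proof (induction n)
    case 0
    from mono[of 0] obtain r where "L r = monom 1 0" by blast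
    then show ?case by (intro exI[of _ "smult (a 0) r"]) (simp add: sm monom_0)
  next
    case (Suc n)
    then obtain p where "L p = (\<Sum>i\<le>n. monom (a i) i)" by blast
    moreover from mono[of "Suc n"] obtain r where "L r = monom 1 (Suc n)" by blast
    ultimately show ?case by (intro exI[of _ "p + smult (a (Suc n)) r"]) (simp add: add sm smult_monom)
  qed
  from sum[of "coeff q" "degree q"] show ?thesis
    by (simp add: L_def poly_as_sum_of_monoms)
qed

section \<open>Energy identities and the a priori estimate\<close>

lemma integral_Re_pairing:
  assumes "L2 f" "L2 g"
  shows "integrable lborel (\<lambda>x. Re (f x * cnj (g x)))"
    and "Re (LINT x|lborel. f x * cnj (g x)) = (LINT x|lborel. Re (f x * cnj (g x)))"
  using L2_mult_integrable[OF assms(1) L2_cnj[OF assms(2)]] by (auto simp del: times_complex.sel)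

text \<open>The operator 1/2 + x d/dx is skew-symmetric: Re ((u/2 + x u') cnj u) is the derivative
  of x |u|^2 / 2. Hence \<gamma> survives only in the boundary term \<open>W\<close> and disappears
  from the identity.\<close>

lemma gp_energy:
  assumes "c > 0"
  shows "Re (LINT x|lborel. gp c (gp_H \<gamma> c p) x * cnj (gp c p x))
    = 1/4 * sqn (gp c (gp_D c p)) + sqn (gp c (pCons 0 p))"
proof -
  note [simp] = L2_gp[OF assms] L2_integrable[OF L2_gp[OF assms]] integral_Re_pairing(1)
  define u u1 u2 h xu where "u = gp c p" "u1 = gp c (gp_D c p)" "u2 = gp c (gp_D c (gp_D c p))"
    "h = gp c (gp_H \<gamma> c p)" "xu = gp c (pCons 0 p)"
  note defs = this
  have h: "h x = - (1/4) * u2 x + complex_of_real (x\<^sup>2) * u x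
     - complex_of_real \<gamma> * (u x / 2 + complex_of_real x * u1 x)" for x
    unfolding defs by (rule gp_H_eq)
  have xu: "xu x = of_real x * u x" for x by (simp add: defs gp_pCons_0)
  define W where "W = (\<lambda>x. - 1/4 * Re (u1 x * cnj (u x)) - \<gamma> / 2 * Re (xu x * cnj (u x)))"
  define w where "w = (\<lambda>x. Re (h x * cnj (u x)) - 1/4 * (cmod (u1 x))\<^sup>2 - (cmod (xu x))\<^sup>2)"
  have d: "((\<lambda>x. Re (u x)) has_real_derivative Re (u1 x)) (at x)" "((\<lambda>x. Im (u x)) has_real_derivative Im (u1 x)) (at x)"
    "((\<lambda>x. Re (u1 x)) has_real_derivative Re (u2 x)) (at x)" "((\<lambda>x. Im (u1 x)) has_real_derivative Im (u2 x)) (at x)" for x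
    unfolding defs has_real_derivative_iff_has_vector_derivative
    by (rule bounded_linear.has_vector_derivative[OF bounded_linear_Re gp_has_vector_derivative]
        bounded_linear.has_vector_derivative[OF bounded_linear_Im gp_has_vector_derivative])+
  have "(LINT x|lborel. w x) = 0"
  proof (rule integral_vector_derivative_eq_0[of W])
    have W: "W = (\<lambda>x. - 1/4 * (Re (u1 x) * Re (u x) + Im (u1 x) * Im (u x)) - \<gamma> / 2 * (x * (Re (u x) * Re (u x) + Im (u x) * Im (u x))))"
      by (simp add: fun_eq_iff W_def xu power2_eq_square power3_eq_cube algebra_simps)
    show "(W has_vector_derivative w x) (at x)" for x
      unfolding has_real_derivative_iff_has_vector_derivative[symmetric] W w_def h xu cmod_power2
      by (rule d derivative_eq_intros refl)+ (simp add: power2_eq_square power3_eq_cube field_simps)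
    show "continuous_on UNIV w"
      unfolding w_def defs by (intro continuous_intros continuous_on_gp)
    show "integrable lborel w" unfolding w_def defs
      by (intro Bochner_Integration.integrable_diff Bochner_Integration.integrable_add integrable_mult_right
          integral_Re_pairing(1) L2_integrable L2_gp assms)
    have "(\<lambda>n. - 1/4 * Re (u1 (s n) * cnj (u (s n))) - \<gamma> / 2 * Re (xu (s n) * cnj (u (s n))))
        \<longlonglongrightarrow> - 1/4 * Re (0 * cnj 0) - \<gamma> / 2 * Re (0 * cnj 0)"
      if "\<And>p. (\<lambda>n. gp c p (s n)) \<longlonglongrightarrow> 0" for s
      unfolding defs by (intro tendsto_intros that)
    from this[of real] this[of "\<lambda>n. - real n"] gp_tendsto_0[OF assms]
    show "(\<lambda>n. W (real n)) \<longlonglongrightarrow> 0" "(\<lambda>n. W (- real n)) \<longlonglongrightarrow> 0"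
      unfolding W_def by (simp_all del: times_complex.sel)
  qed
  moreover have "(LINT x|lborel. w x) = Re (LINT x|lborel. h x * cnj (u x)) - 1/4 * sqn u1 - sqn xu"
    unfolding w_def sqn_def by (subst integral_Re_pairing(2)) (simp_all add: defs del: times_complex.sel cnj.sel)
  ultimately show ?thesis by (simp add: defs)
qed

text \<open>Moving derivatives past the weight x^2 leaves two lower-order terms: -|u|^2/4 from the
  second derivative, via 2 x Re (u' cnj u) = (x |u|^2)' - |u|^2, and \<gamma> x^2 |u|^2 from the
  first-order part. The identity is needed to bound x u' and x^2 u separately, not merely their
  combination inside H u.\<close>

lemma gp_weighted_energy:
  assumes "c > 0"
  shows "Re (LINT x|lborel. gp c (gp_H \<gamma> c p) x * cnj (gp c (pCons 0 (pCons 0 p)) x))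
    = 1/4 * sqn (gp c (pCons 0 (gp_D c p))) + sqn (gp c (pCons 0 (pCons 0 p)))
      + \<gamma> * sqn (gp c (pCons 0 p)) - 1/4 * sqn (gp c p)"
proof -
  note [simp] = L2_gp[OF assms] L2_integrable[OF L2_gp[OF assms]] integral_Re_pairing(1)
  define u u1 u2 h xu xu1 xxu where "u = gp c p" "u1 = gp c (gp_D c p)" "u2 = gp c (gp_D c (gp_D c p))"
    "h = gp c (gp_H \<gamma> c p)" "xu = gp c (pCons 0 p)" "xu1 = gp c (pCons 0 (gp_D c p))"
    "xxu = gp c (pCons 0 (pCons 0 p))"
  note defs = this
  have h: "h x = - (1/4) * u2 x + complex_of_real (x\<^sup>2) * u x
     - complex_of_real \<gamma> * (u x / 2 + complex_of_real x * u1 x)" for x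
    unfolding defs by (rule gp_H_eq)
  have xu: "xu x = of_real x * u x" "xxu x = of_real x * (of_real x * u x)" "xu1 x = of_real x * u1 x" for x
    by (simp_all add: defs gp_pCons_0)
  define W where "W = (\<lambda>x. - 1/4 * Re (xu1 x * cnj (xu x)) + 1/4 * Re (xu x * cnj (u x))
    - \<gamma> / 2 * Re (xxu x * cnj (xu x)))"
  define w where "w = (\<lambda>x. Re (h x * cnj (xxu x)) - 1/4 * (cmod (xu1 x))\<^sup>2 - (cmod (xxu x))\<^sup>2
    - \<gamma> * (cmod (xu x))\<^sup>2 + 1/4 * (cmod (u x))\<^sup>2)"
  have d: "((\<lambda>x. Re (u x)) has_real_derivative Re (u1 x)) (at x)" "((\<lambda>x. Im (u x)) has_real_derivative Im (u1 x)) (at x)"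
    "((\<lambda>x. Re (u1 x)) has_real_derivative Re (u2 x)) (at x)" "((\<lambda>x. Im (u1 x)) has_real_derivative Im (u2 x)) (at x)" for x
    unfolding defs has_real_derivative_iff_has_vector_derivative
    by (rule bounded_linear.has_vector_derivative[OF bounded_linear_Re gp_has_vector_derivative]
        bounded_linear.has_vector_derivative[OF bounded_linear_Im gp_has_vector_derivative])+
  have "(LINT x|lborel. w x) = 0"
  proof (rule integral_vector_derivative_eq_0[of W])
    have W: "W = (\<lambda>x. - 1/4 * (x\<^sup>2 * (Re (u1 x) * Re (u x) + Im (u1 x) * Im (u x))) + 1/4 * (x * (Re (u x) * Re (u x) + Im (u x) * Im (u x)))
        - \<gamma> / 2 * (x ^ 3 * (Re (u x) * Re (u x) + Im (u x) * Im (u x))))"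
      by (simp add: fun_eq_iff W_def xu power2_eq_square power3_eq_cube algebra_simps)
    show "(W has_vector_derivative w x) (at x)" for x
      unfolding has_real_derivative_iff_has_vector_derivative[symmetric] W w_def h xu cmod_power2
      by (rule d derivative_eq_intros refl)+ (simp add: power2_eq_square power3_eq_cube field_simps)
    show "continuous_on UNIV w"
      unfolding w_def defs by (intro continuous_intros continuous_on_gp)
    show "integrable lborel w" unfolding w_def defs
      by (intro Bochner_Integration.integrable_diff Bochner_Integration.integrable_add integrable_mult_right
          integral_Re_pairing(1) L2_integrable L2_gp assms)
    have "(\<lambda>n. - 1/4 * Re (xu1 (s n) * cnj (xu (s n))) + 1/4 * Re (xu (s n) * cnj (u (s n)))
      - \<gamma> / 2 * Re (xxu (s n) * cnj (xu (s n))))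
        \<longlonglongrightarrow> - 1/4 * Re (0 * cnj 0) + 1/4 * Re (0 * cnj 0) - \<gamma> / 2 * Re (0 * cnj 0)"
      if "\<And>p. (\<lambda>n. gp c p (s n)) \<longlonglongrightarrow> 0" for s
      unfolding defs by (intro tendsto_intros that)
    from this[of real] this[of "\<lambda>n. - real n"] gp_tendsto_0[OF assms]
    show "(\<lambda>n. W (real n)) \<longlonglongrightarrow> 0" "(\<lambda>n. W (- real n)) \<longlonglongrightarrow> 0"
      unfolding W_def by (simp_all del: times_complex.sel)
  qed
  moreover have "(LINT x|lborel. w x) = Re (LINT x|lborel. h x * cnj (xxu x)) - 1/4 * sqn xu1 - sqn xxu
      - \<gamma> * sqn xu + 1/4 * sqn u"
    unfolding w_def sqn_def by (subst integral_Re_pairing(2)) (simp_all add: defs del: times_complex.sel cnj.sel)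
  ultimately show ?thesis by (simp add: defs)
qed

text \<open>Cauchy--Schwarz followed by the arithmetic-geometric mean inequality. The coefficient
  1/2 is small enough for the term ||x^2 u||^2 to be absorbed on the left of the weighted energy
  identity.\<close>

lemma Re_pairing_le:
  assumes "L2 f" "L2 g"
  shows "Re (LINT x|lborel. f x * cnj (g x)) \<le> 1/2 * sqn f + 1/2 * sqn g"
proof -
  have "Re (LINT x|lborel. f x * cnj (g x)) \<le> cmod (LINT x|lborel. f x * cnj (g x))"
    by (rule complex_Re_le_cmod)
  also have "\<dots> \<le> sqrt (sqn f) * sqrt (sqn (\<lambda>x. cnj (g x)))"
    by (intro L2_Cauchy_Schwarz assms L2_cnj)
  also have "\<dots> = sqrt (sqn f) * sqrt (sqn g)"
    by (simp add: sqn_def)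
  also have "\<dots> \<le> 1/2 * (sqrt (sqn f))\<^sup>2 + 1/2 * (sqrt (sqn g))\<^sup>2"
    using sum_squares_bound[of "sqrt (sqn f)" "sqrt (sqn g)"] by simp
  finally show ?thesis by (simp add: sqn_nonneg)
qed

text \<open>A single constant for all polynomials transfers a geometric rate of (H - z) p to each of
  the five sequences needed for completeness. The first identity yields ||u||, u' and x u, the
  second x u' and x^2 u, and solving the equation for u'' yields the rest.\<close>

lemma gp_graph_estimate:
  assumes c: "c > 0" and \<gamma>: "\<bar>\<gamma>\<bar> \<le> 1" and z: "Re z < 0"
  obtains K where "\<And>p. max (sqn (gp c p)) (max (sqn (gp c (gp_D c p))) (max (sqn (gp c (gp_D c (gp_D c p))))
      (max (sqn (gp c (pCons 0 (pCons 0 p)))) (sqn (gp c (pCons 0 (gp_D c p)))))))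
    \<le> K * sqn (gp c (gp_H \<gamma> c p - smult z p))"
proof -
  note [simp] = L2_gp[OF c]
  define r where "r = (Re z)\<^sup>2"
  have r: "r > 0" using z by (simp add: r_def)
  define k where "k = 2 + 2 * (cmod z)\<^sup>2 * (1 / r)"
  have k0: "k \<ge> 0" using r by (simp add: k_def)
  \<comment> \<open>The largest bound below is the one for u'': combining \<open>b1\<close> and
    \<open>b2\<close> gives at most 448 \<open>sqn h\<close> + 304 \<open>U\<close>, so 1000 is
    ample.\<close>
  define K where "K = 1000 * (k + 1 / r)"
  have "max (sqn (gp c p)) (max (sqn (gp c (gp_D c p))) (max (sqn (gp c (gp_D c (gp_D c p))))
      (max (sqn (gp c (pCons 0 (pCons 0 p)))) (sqn (gp c (pCons 0 (gp_D c p)))))))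
    \<le> K * sqn (gp c (gp_H \<gamma> c p - smult z p))" for p
  proof -
    define u u1 u2 h xu xu1 xxu f where "u = gp c p" "u1 = gp c (gp_D c p)" "u2 = gp c (gp_D c (gp_D c p))"
      "h = gp c (gp_H \<gamma> c p)" "xu = gp c (pCons 0 p)" "xu1 = gp c (pCons 0 (gp_D c p))"
      "xxu = gp c (pCons 0 (pCons 0 p))" "f = gp c (gp_H \<gamma> c p - smult z p)"
    note defs = this
    have L [simp]: "L2 u" "L2 u1" "L2 u2" "L2 h" "L2 xu" "L2 xu1" "L2 xxu" "L2 f"
      by (simp_all add: defs)
    define U F where "U = sqn u" and "F = sqn f"
    note nn = sqn_nonneg[of u] sqn_nonneg[of u1] sqn_nonneg[of xu] sqn_nonneg[of h] sqn_nonneg[of xxu]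
      sqn_nonneg[of xu1] sqn_nonneg[of f]
    have e1: "Re (LINT x|lborel. h x * cnj (u x)) = 1/4 * sqn u1 + sqn xu"
      unfolding defs by (rule gp_energy[OF c])
    have e2: "Re (LINT x|lborel. h x * cnj (xxu x)) = 1/4 * sqn xu1 + sqn xxu + \<gamma> * sqn xu - 1/4 * U"
      unfolding defs U_def by (rule gp_weighted_energy[OF c])
    have fh: "f = (\<lambda>x. h x - z * u x)" "h = (\<lambda>x. f x + z * u x)"
      by (simp_all add: fun_eq_iff defs gp_diff gp_smult)
    have uu: "(LINT x|lborel. u x * cnj (u x)) = of_real U"
      unfolding U_def sqn_def integral_complex_of_real[symmetric] by (simp only: complex_norm_square)
    have "(LINT x|lborel. f x * cnj (u x)) = (LINT x|lborel. h x * cnj (u x)) - z * (LINT x|lborel. u x * cnj (u x))"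
      unfolding fh(1) by (simp add: left_diff_distrib mult.assoc L2_mult_integrable L2_cnj)
    then have "\<bar>Re z\<bar> * U \<le> Re (LINT x|lborel. f x * cnj (u x))"
      unfolding uu using e1 nn z by simp
    also have "\<dots> \<le> cmod (LINT x|lborel. f x * cnj (u x))" by (rule complex_Re_le_cmod)
    also have "\<dots> \<le> sqrt F * sqrt (sqn (\<lambda>x. cnj (u x)))"
      unfolding F_def by (intro L2_Cauchy_Schwarz L2_cnj) simp_all
    finally have "\<bar>Re z\<bar> * U \<le> sqrt F * sqrt U"
      by (simp add: sqn_def U_def)
    then have "(\<bar>Re z\<bar> * U)\<^sup>2 \<le> (sqrt F * sqrt U)\<^sup>2"
      using nn by (intro power_mono) (simp_all add: U_def)
    then have rUU: "(r * U) * U \<le> F * U"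
      using nn by (simp add: r_def U_def F_def power_mult_distrib power2_eq_square mult_ac)
    have rU: "r * U \<le> F"
    proof (cases "U = 0")
      case True then show ?thesis using nn by (simp add: F_def)
    next
      case False
      then have "U > 0" using nn by (simp add: U_def)
      with rUU show ?thesis by simp
    qed
    have UF: "U \<le> (1 / r) * F" using rU r by (simp add: field_simps)
    have "sqn h \<le> 2 * F + 2 * ((cmod z)\<^sup>2 * U)"
      unfolding fh(2) F_def U_def sqn_scale[symmetric] by (intro sqn_add_le L2_scale) simp_all
    also have "\<dots> \<le> 2 * F + 2 * ((cmod z)\<^sup>2 * ((1 / r) * F))"
      by (intro add_left_mono mult_left_mono UF) auto
    also have "\<dots> = k * F" by (simp add: k_def algebra_simps)
    finally have hF: "sqn h \<le> k * F" .
    have hu: "1/4 * sqn u1 + sqn xu \<le> 1/2 * sqn h + 1/2 * U"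
      using Re_pairing_le[of h u] e1 by (simp add: U_def)
    have "- \<gamma> * sqn xu \<le> 1 * sqn xu"
      using \<gamma> nn by (intro mult_right_mono) auto
    then have hx: "1/4 * sqn xu1 + sqn xxu \<le> 1/2 * sqn h + 1/2 * sqn xxu + sqn xu + 1/4 * U"
      using Re_pairing_le[of h xxu] e2 by simp
    \<comment> \<open>Half of \<open>sqn xxu\<close> in \<open>hx\<close> is absorbed on the left,
      and \<open>sqn xu\<close> on its right is replaced by the bound from
      \<open>hu\<close>.\<close>
    have b1: "sqn u1 \<le> 2 * sqn h + 2 * U" "sqn xu1 \<le> 4 * sqn h + 3 * U" "sqn xxu \<le> 2 * sqn h + 3/2 * U"
      using hu hx nn by simp_all
    \<comment> \<open>The equation h = H u solved for u''.\<close>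
    have u2: "u2 = (\<lambda>x. (4 * xxu x - 4 * h x) - ((2 * \<gamma>) * u x + (4 * \<gamma>) * xu1 x))"
      unfolding fun_eq_iff defs gp_H_eq gp_pCons_0 by (simp add: power2_eq_square algebra_simps)
    have \<gamma>2: "\<gamma>\<^sup>2 * s \<le> s" if "s \<ge> 0" for s
      using \<gamma> that by (simp add: mult_left_le_one_le abs_square_le_1)
    have "sqn u2 \<le> 2 * sqn (\<lambda>x. 4 * xxu x - 4 * h x) + 2 * sqn (\<lambda>x. (2 * \<gamma>) * u x + (4 * \<gamma>) * xu1 x)"
      unfolding u2 by (intro sqn_diff_le L2_add L2_diff L2_scale) simp_all
    also have "sqn (\<lambda>x. 4 * xxu x - 4 * h x) \<le> 2 * sqn (\<lambda>x. 4 * xxu x) + 2 * sqn (\<lambda>x. 4 * h x)"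
      by (intro sqn_diff_le L2_scale) simp_all
    also have "sqn (\<lambda>x. (2 * \<gamma>) * u x + (4 * \<gamma>) * xu1 x) \<le> 2 * sqn (\<lambda>x. (2 * \<gamma>) * u x) + 2 * sqn (\<lambda>x. (4 * \<gamma>) * xu1 x)"
      by (intro sqn_add_le L2_scale) simp_all
    finally have "sqn u2 \<le> 64 * sqn xxu + 64 * sqn h + 16 * (\<gamma>\<^sup>2 * U) + 64 * (\<gamma>\<^sup>2 * sqn xu1)"
      unfolding sqn_scale by (simp add: U_def norm_mult power_mult_distrib)
    then have b2: "sqn u2 \<le> 64 * sqn xxu + 64 * sqn h + 16 * U + 64 * sqn xu1"
      using \<gamma>2[of U] \<gamma>2[of "sqn xu1"] nn by (simp add: U_def)
    have "K * F = 1000 * (k * F) + 1000 * ((1 / r) * F)"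
      by (simp add: K_def algebra_simps)
    then have "U \<le> K * F" "sqn u1 \<le> K * F" "sqn u2 \<le> K * F" "sqn xxu \<le> K * F" "sqn xu1 \<le> K * F"
      using b1 b2 hF UF nn unfolding U_def[symmetric] by linarith+
    then show ?thesis by (simp add: defs U_def F_def)
  qed
  then show ?thesis by (rule that)
qed

section \<open>Density of Gaussian polynomials\<close>


text \<open>With m = n^2 and t = (1 + sin (y/n)) / 2 this is (1 - t^m)^(2^m), a switch polynomial as
  in elementary proofs of Stone--Weierstrass, with threshold t = 1/2. Setting T = (2t)^m, the value
  lies between 1 - T and exp (-T). As n^2 sin (y/n) behaves like n y, T tends to infinity for y > 0
  and to 0 for y < 0. The scale 1/n lets the period of the sine grow, so that a single jump remains
  in the limit.\<close>

lemma tendsto_smooth_step: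
  fixes y :: real
  assumes "y \<noteq> 0"
  shows "(\<lambda>n. (1 - ((1 + sin (y / real n)) / 2) ^ n\<^sup>2) ^ 2 ^ n\<^sup>2) \<longlonglongrightarrow> indicator {..<0} y"
proof -
  define s where "s = (\<lambda>n. sin (y / real n))"
  define T where "T = (\<lambda>n. (1 + s n) ^ n\<^sup>2)"
  define F where "F = (\<lambda>n. (1 - ((1 + s n) / 2) ^ n\<^sup>2) ^ 2 ^ n\<^sup>2)"
  have s: "-1 \<le> s n" "s n \<le> 1" for n by (simp_all add: s_def)
  have eq: "((1 + s n) / 2) ^ n\<^sup>2 = T n / 2 ^ n\<^sup>2" for n by (simp add: T_def power_divide)
  have u: "0 \<le> T n / 2 ^ n\<^sup>2" "T n / 2 ^ n\<^sup>2 \<le> 1" for n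
    unfolding eq[symmetric] using s[of n] by (auto intro: power_le_one)
  have up: "F n \<le> exp (- T n)" for n
  proof -
    have "F n \<le> exp (- (T n / 2 ^ n\<^sup>2)) ^ 2 ^ n\<^sup>2"
      unfolding F_def eq using u[of n] exp_ge_add_one_self[of "- (T n / 2 ^ n\<^sup>2)"] by (intro power_mono) auto
    also have "\<dots> = exp (- T n)" by (simp flip: exp_of_nat_mult)
    finally show ?thesis .
  qed
  have lo: "1 - T n \<le> F n" for n
    using Bernoulli_inequality[of "- (T n / 2 ^ n\<^sup>2)" "2 ^ n\<^sup>2"] u[of n] by (simp add: F_def eq)
  have F01: "0 \<le> F n" "F n \<le> 1" for n
    unfolding F_def eq using u[of n] by (auto intro: power_le_one)
  have "F \<longlonglongrightarrow> indicator {..<0} y"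
  proof (cases "y > 0")
    case True
    have "filterlim (\<lambda>n. (real n)\<^sup>2 * sin (y / real n)) at_top sequentially"
      using True by real_asymp
    then have sT: "filterlim (\<lambda>n. 1 + (real n)\<^sup>2 * s n) at_top sequentially"
      unfolding s_def by (rule filterlim_tendsto_add_at_top[OF tendsto_const])
    have "filterlim T at_top sequentially"
    proof (rule filterlim_at_top_mono[OF sT])
      have "1 + (real n)\<^sup>2 * s n \<le> T n" for n
        using Bernoulli_inequality[of "s n" "n\<^sup>2"] s[of n] by (simp add: T_def)
      then show "\<forall>\<^sub>F n in sequentially. 1 + (real n)\<^sup>2 * s n \<le> T n" by simp
    qed
    then have "(\<lambda>n. exp (- T n)) \<longlonglongrightarrow> 0"
      by (intro filterlim_compose[OF exp_at_bot]) (simp add: filterlim_uminus_at_top)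
    then have "F \<longlonglongrightarrow> 0"
      by (rule Lim_null_comparison[rotated]) (use up F01 in auto)
    then show ?thesis using True by simp
  next
    case False
    then have y: "y < 0" using assms by simp
    have "filterlim (\<lambda>n. (real n)\<^sup>2 * sin (y / real n)) at_bot sequentially"
      using y by real_asymp
    then have "(\<lambda>n. exp ((real n)\<^sup>2 * s n)) \<longlonglongrightarrow> 0"
      unfolding s_def by (rule filterlim_compose[OF exp_at_bot])
    moreover have "T n \<le> exp ((real n)\<^sup>2 * s n)" for n
    proof -
      have "T n \<le> exp (s n) ^ n\<^sup>2"
        unfolding T_def using s[of n] by (intro power_mono) auto
      then show ?thesis by (simp flip: exp_of_nat_mult)
    qed
    moreover have "norm (F n - 1) \<le> T n" for n using lo[of n] F01[of n] by simp
    ultimately have "(\<lambda>n. F n - 1) \<longlonglongrightarrow> 0"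
      by (intro Lim_null_comparison[of "\<lambda>n. F n - 1" "\<lambda>n. exp ((real n)\<^sup>2 * s n)"])
        (auto intro: always_eventually order_trans)
    then have "F \<longlonglongrightarrow> 1" by (rule LIM_zero_cancel)
    then show ?thesis using y by simp
  qed
  then show ?thesis by (simp add: F_def s_def)
qed

text \<open>The functions \<open>F\<close> with \<open>S (F * exp (- c x\<^sup>2))\<close> contain the polynomials, hence by Taylor
  expansion the trigonometric functions, hence the polynomials in \<open>sin ((x - a) / n)\<close>. By
  \<open>tendsto_smooth_step\<close> these converge boundedly to the indicator of a half-line, and half-lines are an
  intersection-stable generator of the Borel sets.\<close>

lemma L2_gaussian_induct:
  fixes S :: "(real \<Rightarrow> complex) \<Rightarrow> bool"
  assumes c: "c > 0" and f: "L2 f"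
    and base: "\<And>n. S (gp c (monom 1 n))"
    and add: "\<And>f g. S f \<Longrightarrow> S g \<Longrightarrow> S (\<lambda>x. f x + g x)"
    and scale: "\<And>a f. S f \<Longrightarrow> S (\<lambda>x. a * f x)"
    and lim: "\<And>F f. (\<And>n. S (F n)) \<Longrightarrow> L2_lim F f \<Longrightarrow> S f"
  shows "S f"
proof -
  define G where "G = gp c 1"
  have G: "G x = complex_of_real (exp (- c * x\<^sup>2))" for x by (simp add: G_def gp_def)
  have LG: "L2 G" unfolding G_def by (rule L2_gp[OF c])
  have [measurable]: "G \<in> borel_measurable borel" unfolding G_def by simp
  define P where "P = (\<lambda>F. S (\<lambda>x. F x * G x))"
  have Padd: "P (\<lambda>x. F x + H x)" if "P F" "P H" for F H
    using add[of "\<lambda>x. F x * G x" "\<lambda>x. H x * G x"] that by (simp add: P_def distrib_right)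
  have Pscale: "P (\<lambda>x. a * F x)" if "P F" for a F
    using scale[of "\<lambda>x. F x * G x" a] that by (simp add: P_def mult.assoc)
  have Pmono: "P (\<lambda>x. complex_of_real x ^ n)" for n
  proof -
    have "gp c (monom 1 n) = (\<lambda>x. complex_of_real x ^ n * G x)"
      by (rule ext) (simp add: gp_def G poly_monom)
    with base[of n] show ?thesis unfolding P_def by (simp only:)
  qed
  have P0: "P (\<lambda>x. 0)"
    using Pscale[OF Pmono, of 0 0] by simp
  have Psum: "P (\<lambda>x. \<Sum>i\<in>I. F i x)" if "finite I" "\<And>i. i \<in> I \<Longrightarrow> P (F i)" for F and I :: "'i set"
    using that by (induction I rule: finite_induct) (auto intro: P0 Padd)
  have Plim: "P F" if "\<And>n. P (H n)" "\<And>n. H n \<in> borel_measurable borel" "F \<in> borel_measurable borel"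
     "L2 g" "\<And>n x. cmod (H n x) * exp (- c * x\<^sup>2) \<le> cmod (g x)" "AE x in lborel. (\<lambda>n. H n x) \<longlonglongrightarrow> F x"
   for F H and g :: "real \<Rightarrow> complex"
    unfolding P_def
  proof (rule lim)
    note [measurable] = that(2,3)
    show "S (\<lambda>x. H n x * G x)" for n using that(1) by (simp add: P_def)
    show "L2_lim (\<lambda>n x. H n x * G x) (\<lambda>x. F x * G x)"
    proof (rule L2_dominated_lim[OF _ _ that(4)])
      show "cmod (H n x * G x) \<le> cmod (g x)" for n x
        using that(5)[of n x] by (simp add: norm_mult G)
      show "AE x in lborel. (\<lambda>n. H n x * G x) \<longlonglongrightarrow> F x * G x"
        using that(6) by eventually_elim (intro tendsto_intros)
    qed simp_all
  qed
  \<comment> \<open>Taylor polynomials of the exponential are bounded by exp |k x|, and completing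
    the square gives exp (|k x| - c x^2) \<le> exp (k^2/(2c)) exp (-c x^2/2). Half of the Gaussian
    decay pays for the majorant.\<close>
  have Pcis: "P (\<lambda>x. cis (k * x))" for k
  proof (rule Plim[of "\<lambda>n x. \<Sum>j<n. (\<i> * of_real (k * x)) ^ j /\<^sub>R fact j" _
        "gp (c / 2) [:of_real (exp (k\<^sup>2 / (2 * c))):]"])
    fix n :: nat
    have "P (\<lambda>x. \<Sum>j<n. ((\<i> * of_real k) ^ j / of_real (fact j)) * complex_of_real x ^ j)"
      by (intro Psum Pscale Pmono) simp
    then show "P (\<lambda>x. \<Sum>j<n. (\<i> * of_real (k * x)) ^ j /\<^sub>R fact j)"
      by (simp add: power_mult_distrib scaleR_conv_of_real field_simps)
    fix x :: real
    have "cmod (\<Sum>j<n. (\<i> * of_real (k * x)) ^ j /\<^sub>R fact j) \<le> (\<Sum>j<n. \<bar>k * x\<bar> ^ j /\<^sub>R fact j)"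
      by (rule sum_norm_le) (simp add: norm_power norm_mult abs_mult)
    also have "\<dots> \<le> exp \<bar>k * x\<bar>"
      unfolding exp_def by (rule sum_le_suminf[OF summable_exp_generic]) auto
    finally have "cmod (\<Sum>j<n. (\<i> * of_real (k * x)) ^ j /\<^sub>R fact j) * exp (- c * x\<^sup>2)
        \<le> exp \<bar>k * x\<bar> * exp (- c * x\<^sup>2)"
      by (rule mult_right_mono) simp
    also have "\<dots> = exp (\<bar>k * x\<bar> + - c * x\<^sup>2)" by (rule exp_add[symmetric])
    also have "\<dots> \<le> exp (k\<^sup>2 / (2 * c) + - (c / 2) * x\<^sup>2)"
    proof -
      have "0 \<le> (\<bar>k\<bar> - c * \<bar>x\<bar>)\<^sup>2" by simp
      then have "2 * c * \<bar>k * x\<bar> \<le> k\<^sup>2 + c\<^sup>2 * x\<^sup>2"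
        by (simp add: power2_diff power_mult_distrib abs_mult mult_ac)
      then have "\<bar>k * x\<bar> \<le> (k\<^sup>2 + c\<^sup>2 * x\<^sup>2) / (2 * c)"
        using c by (simp add: pos_le_divide_eq mult_ac)
      also have "\<dots> = k\<^sup>2 / (2 * c) + c / 2 * x\<^sup>2"
        using c by (simp add: field_simps power2_eq_square)
      finally show ?thesis by simp
    qed
    also have "\<dots> = cmod (gp (c / 2) [:of_real (exp (k\<^sup>2 / (2 * c))):] x)"
      unfolding exp_add by (simp add: gp_def norm_mult)
    finally show "cmod (\<Sum>j<n. (\<i> * of_real (k * x)) ^ j /\<^sub>R fact j) * exp (- c * x\<^sup>2)
        \<le> cmod (gp (c / 2) [:of_real (exp (k\<^sup>2 / (2 * c))):] x)" .
  next
    show "AE x in lborel. (\<lambda>n. \<Sum>j<n. (\<i> * of_real (k * x)) ^ j /\<^sub>R fact j) \<longlonglongrightarrow> cis (k * x)"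
    proof (rule AE_I2)
      fix x
      show "(\<lambda>n. \<Sum>j<n. (\<i> * of_real (k * x)) ^ j /\<^sub>R fact j) \<longlonglongrightarrow> cis (k * x)"
        unfolding cis_conv_exp exp_def by (rule summable_LIMSEQ[OF summable_exp_generic])
    qed
    show "(\<lambda>x. cis (k * x)) \<in> borel_measurable borel"
      by (intro borel_measurable_continuous_onI continuous_intros)
    show "L2 (gp (c / 2) [:of_real (exp (k\<^sup>2 / (2 * c))):])"
      using c by (intro L2_gp) simp
  qed measurable
  \<comment> \<open>The frequency k is kept general in the induction because each factor sin (a + b
    x), written with exponentials, shifts it by b and by -b.\<close>
  have Psin_cis: "P (\<lambda>x. of_real (sin (a + b * x)) ^ j * cis (k * x))" for a b k j
  proof (induction j arbitrary: k)
    case 0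
    show ?case using Pcis[of k] by simp
  next
    case (Suc j)
    have "of_real (sin y) = (cis y - cis (- y)) / (2 * \<i>)" for y
      by (simp add: complex_eq_iff)
    then have eq: "of_real (sin (a + b * x)) ^ Suc j * cis (k * x)
      = (cis a / (2 * \<i>)) * (of_real (sin (a + b * x)) ^ j * cis ((k + b) * x))
        + (- cis (- a) / (2 * \<i>)) * (of_real (sin (a + b * x)) ^ j * cis ((k - b) * x))" for x
    proof -
      have "of_real (sin (a + b * x)) * cis (k * x)
         = (cis (a + b * x) * cis (k * x) - cis (- (a + b * x)) * cis (k * x)) / (2 * \<i>)"
        by (subst \<open>\<And>y. of_real (sin y) = (cis y - cis (- y)) / (2 * \<i>)\<close>) (simp add: left_diff_distrib)
      also have "cis (a + b * x) * cis (k * x) = cis a * cis ((k + b) * x)"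
        by (simp add: cis_mult algebra_simps)
      also have "cis (- (a + b * x)) * cis (k * x) = cis (- a) * cis ((k - b) * x)"
        by (simp add: cis_mult algebra_simps)
      finally have "of_real (sin (a + b * x)) * cis (k * x)
        = (cis a * cis ((k + b) * x) - cis (- a) * cis ((k - b) * x)) / (2 * \<i>)" .
      then have "of_real (sin (a + b * x)) ^ j * (of_real (sin (a + b * x)) * cis (k * x))
        = of_real (sin (a + b * x)) ^ j * ((cis a * cis ((k + b) * x) - cis (- a) * cis ((k - b) * x)) / (2 * \<i>))"
        by (simp only:)
      then show ?thesis
        by (simp add: diff_divide_distrib right_diff_distrib mult_ac)
    qed
    show ?case unfolding eq by (intro Padd Pscale Suc)
  qed
  have Ppoly: "P (\<lambda>x. of_real (poly q (sin (a + b * x))))" for a b and q :: "real poly"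
  proof -
    have "P (\<lambda>x. \<Sum>i\<le>degree q. of_real (coeff q i) * (of_real (sin (a + b * x)) ^ i * cis (0 * x)))"
      by (intro Psum Pscale Psin_cis) simp
    then show ?thesis by (simp add: poly_altdef)
  qed
  have Phalf: "P (indicator {..<a})" for a :: real
  proof (rule Plim[OF _ _ _ LG])
    define q :: "nat \<Rightarrow> real poly" where "q = (\<lambda>n. (1 - [:1 / 2, 1 / 2:] ^ n\<^sup>2) ^ 2 ^ n\<^sup>2)"
    define F where "F = (\<lambda>n x. poly (q n) (sin ((x - a) / real n)))"
    have F: "F n x = (1 - ((1 + sin ((x - a) / real n)) / 2) ^ n\<^sup>2) ^ 2 ^ n\<^sup>2" for n x
      by (simp add: F_def q_def add_divide_distrib)
    show "P (\<lambda>x. of_real (F n x))" for n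
      using Ppoly[of "q n" "- a / real n" "1 / real n"] by (simp add: F_def diff_divide_distrib)
    show "(\<lambda>x. complex_of_real (F n x)) \<in> borel_measurable borel" for n unfolding F by measurable
    show "cmod (of_real (F n x)) * exp (- c * x\<^sup>2) \<le> cmod (G x)" for n x
    proof -
      define s where "s = (1 + sin ((x - a) / real n)) / 2"
      have "0 \<le> s" "s \<le> 1"
        using sin_ge_minus_one[of "(x - a) / real n"] sin_le_one[of "(x - a) / real n"]
        unfolding s_def by (simp, linarith) simp
      then have "0 \<le> F n x" "F n x \<le> 1"
        unfolding F s_def[symmetric] by (auto intro!: power_le_one zero_le_power simp: power_le_one)
      then show ?thesis by (simp add: G mult_left_le_one_le)
    qed
    \<comment> \<open>At x = a itself the approximations tend to 1/e rather than to 0 or 1, but a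
      single point is a null set.\<close>
    have "AE x in lborel. x \<noteq> a" by (rule AE_lborel_singleton)
    then show "AE x in lborel. (\<lambda>n. complex_of_real (F n x)) \<longlonglongrightarrow> indicator {..<a} x"
    proof eventually_elim
      case (elim x)
      then have "(\<lambda>n. F n x) \<longlonglongrightarrow> indicator {..<0} (x - a)"
        unfolding F by (intro tendsto_smooth_step) simp
      then have "(\<lambda>n. complex_of_real (F n x)) \<longlonglongrightarrow> of_real (indicator {..<0} (x - a))"
        by (rule tendsto_of_real)
      then show ?case
        by (cases "x < a") (simp_all add: indicator_def)
    qed
  qed simp
  have Pborel: "P (indicator A)" if "A \<in> sets borel" for A :: "real set"
  proof -
    have "Int_stable (range lessThan :: real set set)"
      unfolding Int_stable_def
    proof clarsimp
      fix a b :: real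
      have "{..<a} \<inter> {..<b} = {..<min a b}" by auto
      then show "{..<a} \<inter> {..<b} \<in> range lessThan" by simp
    qed
    moreover have "range lessThan \<subseteq> Pow (UNIV :: real set)" by simp
    moreover have "A \<in> sigma_sets UNIV (range lessThan)"
      using that unfolding borel_Iio by simp
    ultimately show ?thesis
    proof (induction rule: sigma_sets_induct_disjoint)
      case (basic A) then show ?case using Phalf by auto
    next
      case empty show ?case using P0 by (simp add: indicator_def[abs_def])
    next
      case (compl A)
      have "(indicator (UNIV - A) :: real \<Rightarrow> complex) = (\<lambda>x. complex_of_real x ^ 0 + (-1) * indicator A x)"
        by (auto simp: fun_eq_iff indicator_def)
      then show ?case using Padd[OF Pmono[of 0] Pscale[OF compl(2), of "-1"]] by (simp only:)
    next
      case (union A)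
      have [measurable]: "A i \<in> sets borel" for i
        using union(2) unfolding borel_Iio by auto
      show ?case
      proof (rule Plim[OF _ _ _ LG])
        show "P (\<lambda>x. \<Sum>i<n. indicator (A i) x)" for n by (intro Psum union) simp
        have ind: "(\<Sum>i<n. indicator (A i) x :: complex) = indicator (\<Union>i<n. A i) x" for n x
        proof (rule indicator_UN_disjoint[symmetric])
          show "disjoint_family_on A {..<n}"
            using union(1) by (auto simp: disjoint_family_on_def)
        qed simp
        show "cmod (\<Sum>i<n. indicator (A i) x) * exp (- c * x\<^sup>2) \<le> cmod (G x)" for n x
          unfolding ind by (simp add: G indicator_def)
        show "AE x in lborel. (\<lambda>n. \<Sum>i<n. indicator (A i) x :: complex) \<longlonglongrightarrow> indicator (\<Union>i. A i) x"
          unfolding ind by (intro AE_I2 LIMSEQ_indicator_UN)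
      qed simp_all
    qed
  qed
  have Psimple: "P s" if s: "simple_function lborel s" for s
  proof -
    have "finite (range s)" using simple_functionD(1)[OF s] by simp
    moreover have "s -` {y} \<in> sets borel" for y using simple_functionD(2)[OF s, of "{y}"] by simp
    ultimately have "P (\<lambda>x. \<Sum>y\<in>range s. y * indicator (s -` {y}) x)"
      by (intro Psum Pscale Pborel)
    moreover have "(\<Sum>y\<in>range s. y * indicator (s -` {y}) x) = s x" for x
    proof -
      have "(\<Sum>y\<in>range s. y * indicator (s -` {y}) x) = (\<Sum>y\<in>range s. if y = s x then y else 0)"
        by (intro sum.cong) (auto simp: indicator_def)
      also have "\<dots> = s x" using \<open>finite (range s)\<close> by simp
      finally show ?thesis .
    qed
    ultimately show ?thesis by simp
  qed
  \<comment> \<open>The quotient of f by the Gaussian need not be in L2. Its approximating simple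
    functions are bounded by 2 |F|, so after multiplication by the Gaussian they are dominated by 2
    |f|.\<close>
  define F where "F = (\<lambda>x. f x * of_real (exp (c * x\<^sup>2)))"
  note [measurable] = L2_measurable[OF f]
  have Fm: "F \<in> borel_measurable lborel" unfolding F_def by measurable
  from borel_measurable_implies_sequence_metric[OF Fm, of 0] obtain s where
    s: "\<And>i. simple_function lborel (s i)" "\<And>x. (\<lambda>i. s i x) \<longlonglongrightarrow> F x" "\<And>i x. cmod (s i x) \<le> 2 * cmod (F x)"
    by (auto simp: dist_norm)
  have exp1: "exp (c * x\<^sup>2) * exp (- c * x\<^sup>2) = 1" for x by (simp flip: exp_add)
  have "P F"
  proof (rule Plim[of s])
    show "P (s n)" for n by (rule Psimple[OF s(1)])
    show "s n \<in> borel_measurable borel" for n using borel_measurable_simple_function[OF s(1)] by simp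
    show "F \<in> borel_measurable borel" using Fm by simp
    show "L2 (\<lambda>x. 2 * f x)" by (rule L2_scale[OF f])
    show "AE x in lborel. (\<lambda>n. s n x) \<longlonglongrightarrow> F x" using s(2) by simp
    show "cmod (s n x) * exp (- c * x\<^sup>2) \<le> cmod (2 * f x)" for n x
    proof -
      have "cmod (s n x) * exp (- c * x\<^sup>2) \<le> 2 * cmod (F x) * exp (- c * x\<^sup>2)"
        by (intro mult_right_mono s) simp
      also have "\<dots> = 2 * cmod (f x) * (exp (c * x\<^sup>2) * exp (- c * x\<^sup>2))"
        by (simp add: F_def norm_mult)
      finally show ?thesis unfolding exp1 by (simp add: norm_mult)
    qed
  qed
  moreover have "F x * G x = f x" for x
  proof -
    have "F x * G x = f x * of_real (exp (c * x\<^sup>2) * exp (- c * x\<^sup>2))"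
      by (simp only: F_def G of_real_mult mult.assoc)
    then show ?thesis unfolding exp1 by simp
  qed
  ultimately show "S f" by (simp add: P_def)
qed

lemma gp_dense:
  assumes c: "c > 0" and f: "L2 f" and e: "e > 0"
  shows "\<exists>p. sqn (\<lambda>x. f x - gp c p x) < e"
proof -
  define S where "S = (\<lambda>f. L2 f \<and> (\<forall>e>0. \<exists>p. sqn (\<lambda>x. f x - gp c p x) < e))"
  note [simp] = L2_gp[OF c]
  have "S f"
  proof (rule L2_gaussian_induct[OF c f])
    show "S (gp c (monom 1 n))" for n
      unfolding S_def by (auto intro!: exI[of _ "monom 1 n"] simp: sqn_def)
  next
    fix f g assume S: "S f" "S g"
    show "S (\<lambda>x. f x + g x)"
      unfolding S_def
    proof (intro conjI allI impI)
      show "L2 (\<lambda>x. f x + g x)" using S by (simp add: S_def L2_add)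
      fix e :: real assume "e > 0"
      then obtain p q where pq: "sqn (\<lambda>x. f x - gp c p x) < e / 4" "sqn (\<lambda>x. g x - gp c q x) < e / 4"
        using S unfolding S_def by (meson divide_pos_pos zero_less_numeral)
      have "sqn (\<lambda>x. (f x - gp c p x) + (g x - gp c q x))
          \<le> 2 * sqn (\<lambda>x. f x - gp c p x) + 2 * sqn (\<lambda>x. g x - gp c q x)"
        using S by (intro sqn_add_le L2_diff) (simp_all add: S_def)
      with pq show "\<exists>p. sqn (\<lambda>x. f x + g x - gp c p x) < e"
        by (intro exI[of _ "p + q"]) (simp add: gp_add algebra_simps)
    qed
  next
    fix f a assume S: "S f"
    show "S (\<lambda>x. a * f x)"
      unfolding S_def
    proof (intro conjI allI impI)
      show "L2 (\<lambda>x. a * f x)" using S by (simp add: S_def L2_scale)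
      fix e :: real assume e: "e > 0"
      \<comment> \<open>The added 1 keeps the divisor positive when a = 0.\<close>
      define k where "k = (cmod a)\<^sup>2 + 1"
      have k: "k > 0" by (simp add: k_def add_nonneg_pos)
      then obtain p where p: "sqn (\<lambda>x. f x - gp c p x) < e / k"
        using S e unfolding S_def by (meson divide_pos_pos)
      have "sqn (\<lambda>x. a * (f x - gp c p x)) \<le> k * sqn (\<lambda>x. f x - gp c p x)"
        unfolding sqn_scale by (intro mult_right_mono sqn_nonneg) (simp add: k_def)
      also have "\<dots> < e" using p k by (simp add: field_simps)
      finally show "\<exists>p. sqn (\<lambda>x. a * f x - gp c p x) < e"
        by (intro exI[of _ "smult a p"]) (simp add: gp_smult algebra_simps)
    qed
  next
    fix F f assume S: "\<And>n. S (F n)" and lim: "L2_lim F f"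
    show "S f"
      unfolding S_def
    proof (intro conjI allI impI)
      show "L2 f" using lim by (simp add: L2_lim_def)
      fix e :: real assume e: "e > 0"
      have "(\<lambda>n. sqn (\<lambda>x. F n x - f x)) \<longlonglongrightarrow> 0" using lim by (simp add: L2_lim_def)
      from order_tendstoD(2)[OF this, of "e / 4"] e obtain n where n: "sqn (\<lambda>x. F n x - f x) < e / 4"
        by (auto simp: eventually_sequentially)
      obtain p where p: "sqn (\<lambda>x. F n x - gp c p x) < e / 4"
        using S[of n] e unfolding S_def by (meson divide_pos_pos zero_less_numeral)
      have "sqn (\<lambda>x. (F n x - gp c p x) - (F n x - f x)) \<le> 2 * sqn (\<lambda>x. F n x - gp c p x) + 2 * sqn (\<lambda>x. F n x - f x)"
        using lim by (intro sqn_diff_le L2_diff) (auto simp: L2_lim_def)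
      with n p show "\<exists>p. sqn (\<lambda>x. f x - gp c p x) < e"
        by (intro exI[of _ p]) simp
    qed
  qed
  then show ?thesis using e by (simp add: S_def)
qed

text \<open>The functions with vanishing pairing against w satisfy all closure conditions of
  \<open>L2_gaussian_induct\<close>, so \<open>cnj\<close> of w is among them; its pairing with w is
  the squared norm of w.\<close>

lemma AE_0_if_orthogonal_gp:
  assumes c: "c > 0" and w: "L2 w" and orth: "\<And>p. (LINT x|lborel. w x * gp c p x) = 0"
  shows "AE x in lborel. w x = 0"
proof -
  define S where "S = (\<lambda>f. L2 f \<and> (LINT x|lborel. w x * f x) = 0)"
  have "S (\<lambda>x. cnj (w x))"
  proof (rule L2_gaussian_induct[OF c L2_cnj[OF w]])
    show "S (gp c (monom 1 n))" for n by (simp add: S_def L2_gp[OF c] orth)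
    show "S (\<lambda>x. f x + g x)" if "S f" "S g" for f g
      using that w by (simp add: S_def L2_add distrib_left L2_mult_integrable)
    show "S (\<lambda>x. a * f x)" if "S f" for a f
    proof -
      have "(LINT x|lborel. w x * (a * f x)) = a * (LINT x|lborel. w x * f x)"
        by (simp add: mult.left_commute)
      then show ?thesis using that by (simp add: S_def L2_scale)
    qed
    show "S f" if S: "\<And>n. S (F n)" and lim: "L2_lim F f" for F f
    proof -
      have "(\<lambda>n. LINT x|lborel. w x * F n x) \<longlonglongrightarrow> (LINT x|lborel. w x * f x)"
        by (rule L2_lim_pairing[OF L2_lim_const[OF w] lim])
      moreover have "(\<lambda>n. LINT x|lborel. w x * F n x) = (\<lambda>n. 0)" using S by (simp add: S_def)
      ultimately have "(LINT x|lborel. w x * f x) = 0"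
        using LIMSEQ_unique[OF tendsto_const] by metis
      then show ?thesis using lim by (simp add: S_def L2_lim_def)
    qed
  qed
  then have "complex_of_real (sqn w) = 0"
    unfolding S_def sqn_def integral_complex_of_real[symmetric] by (simp only: complex_norm_square)
  then show ?thesis using sqn_eq_0_iff[OF w] by simp
qed

section \<open>Test functions and weak derivatives\<close>


text \<open>Recursive counterpart of the iterated derivatives in \<open>test_fun\<close>. It peels
  off the first derivative, so that closure under sums, products and affine substitutions goes by
  induction on the order.\<close>

primrec diff_times :: "nat \<Rightarrow> (real \<Rightarrow> real) \<Rightarrow> bool" where
  "diff_times 0 f \<longleftrightarrow> True"
| "diff_times (Suc n) f \<longleftrightarrow> (\<forall>x. f differentiable (at x)) \<and> diff_times n (deriv f)"

lemma diff_times_iff: "diff_times n f \<longleftrightarrow> (\<forall>m<n. \<forall>x. (deriv ^^ m) f differentiable (at x))"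
proof (induction n arbitrary: f)
  case (Suc n)
  have "(\<forall>m<Suc n. \<forall>x. (deriv ^^ m) f differentiable (at x)) \<longleftrightarrow>
    (\<forall>x. f differentiable (at x)) \<and> (\<forall>m<n. \<forall>x. (deriv ^^ Suc m) f differentiable (at x))"
    by (auto simp: less_Suc_eq_0_disj)
  then show ?case using Suc by (simp add: funpow_Suc_right del: funpow.simps)
qed simp

lemma test_fun_iff:
  "test_fun \<phi> \<longleftrightarrow> (\<forall>n. diff_times n \<phi>) \<and> (\<exists>R. \<forall>x. R < \<bar>x\<bar> \<longrightarrow> \<phi> x = 0)"
  unfolding test_fun_def diff_times_iff by blast

lemma diff_times_SucD: "diff_times (Suc n) f \<Longrightarrow> diff_times n f"
  by (simp add: diff_times_iff)

text \<open>A family closed under differentiation consists of smooth functions. It is applied to the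
  constants, to the functions \<open>flat q\<close>, and to the real parts of Gaussian
  polynomials.\<close>

lemma diff_times_coinduct:
  assumes "f \<in> X" "\<And>f. f \<in> X \<Longrightarrow> \<exists>g\<in>X. \<forall>x. (f has_real_derivative g x) (at x)"
  shows "diff_times n f"
  using assms(1)
proof (induction n arbitrary: f)
  case (Suc n)
  from assms(2)[OF Suc.prems] obtain g where g: "g \<in> X" "\<And>x. (f has_real_derivative g x) (at x)"
    by blast
  then have "deriv f = g" by (intro ext DERIV_imp_deriv)
  then show ?case using Suc.IH[OF g(1)] g(2) by (auto simp: real_differentiable_def)
qed simp

lemma deriv_has_real_derivative:
  "f differentiable (at x) \<Longrightarrow> (f has_real_derivative deriv f x) (at x)" for f :: "real \<Rightarrow> real"
  by (simp add: DERIV_deriv_iff_real_differentiable)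

lemma diff_times_add: "diff_times n f \<Longrightarrow> diff_times n g \<Longrightarrow> diff_times n (\<lambda>x. f x + g x)"
proof (induction n arbitrary: f g)
  case (Suc n)
  then have "deriv (\<lambda>x. f x + g x) = (\<lambda>x. deriv f x + deriv g x)"
    by (intro ext DERIV_imp_deriv) (auto intro!: derivative_eq_intros deriv_has_real_derivative)
  then show ?case using Suc by (auto intro: differentiable_add)
qed simp

lemma diff_times_mult: "diff_times n f \<Longrightarrow> diff_times n g \<Longrightarrow> diff_times n (\<lambda>x. f x * g x)"
proof (induction n arbitrary: f g)
  case (Suc n)
  then have "deriv (\<lambda>x. f x * g x) = (\<lambda>x. deriv f x * g x + f x * deriv g x)"
    by (intro ext DERIV_imp_deriv) (auto intro!: derivative_eq_intros deriv_has_real_derivative)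
  moreover have "diff_times n (\<lambda>x. deriv f x * g x + f x * deriv g x)"
    using Suc by (intro diff_times_add Suc.IH) (auto intro: diff_times_SucD)
  ultimately show ?case using Suc by (auto intro: differentiable_mult)
qed simp

lemma diff_times_affine: "diff_times n f \<Longrightarrow> diff_times n (\<lambda>x. f (a * x + b))"
proof (induction n arbitrary: f)
  case (Suc n)
  then have d: "((\<lambda>x. f (a * x + b)) has_real_derivative a * deriv f (a * x + b)) (at x)" for x
  proof -
    have a: "((\<lambda>x. a * x + b) has_real_derivative a) (at x)"
      by (auto intro!: derivative_eq_intros)
    have "f differentiable (at (a * x + b))" using Suc.prems by simp
    from DERIV_chain2[OF deriv_has_real_derivative[OF this] a]
    show ?thesis by (simp only: mult.commute[of _ a])
  qed
  then have "deriv (\<lambda>x. f (a * x + b)) = (\<lambda>x. a * deriv f (a * x + b))"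
    by (intro ext DERIV_imp_deriv)
  moreover have "diff_times n (\<lambda>x. a)"
    by (rule diff_times_coinduct[of _ "range (\<lambda>c x. c)"]) (auto intro!: derivative_eq_intros)
  then have "diff_times n (\<lambda>x. a * deriv f (a * x + b))"
    using Suc by (intro diff_times_mult) auto
  ultimately show ?case using d by (auto simp: real_differentiable_def)
qed simp

text \<open>The classical smooth function exp(-1/x) on the positive half-line, with polynomials in
  1/x as prefactors so that the family is closed under differentiation.\<close>

definition flat :: "real poly \<Rightarrow> real \<Rightarrow> real"
  where "flat q x = (if 0 < x then poly q (1 / x) * exp (- (1 / x)) else 0)"

lemma poly_exp_minus_at_top: "((\<lambda>y. poly q y * exp (- y)) \<longlongrightarrow> 0) at_top" for q :: "real poly"
proof -
  have "((\<lambda>y. \<Sum>i\<le>degree q. coeff q i * (y ^ i / exp y)) \<longlongrightarrow> (\<Sum>i\<le>degree q. coeff q i * 0)) at_top"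
    by (intro tendsto_intros tendsto_power_div_exp_0)
  then show ?thesis
    by (simp add: poly_altdef sum_distrib_right exp_minus divide_inverse mult.assoc)
qed

text \<open>Away from 0 this is the chain rule with y = 1/x and dy/dx = -y^2. At 0 the difference
  quotient from the right is y q(y) exp(-y) with y tending to infinity, and from the left it is
  0.\<close>

lemma flat_has_real_derivative:
  "(flat q has_real_derivative flat (monom 1 2 * (q - pderiv q)) x) (at x)"
proof (cases x "0 :: real" rule: linorder_cases)
  case less
  have "((\<lambda>x. 0) has_real_derivative 0) (at x)" by simp
  then have "(flat q has_real_derivative 0) (at x)"
    by (rule has_field_derivative_transform_within_open[of _ _ _ "{..<0}"]) (use less in \<open>auto simp: flat_def\<close>)
  then show ?thesis using less by (simp add: flat_def)
next
  case greater
  have "((\<lambda>x. poly q (1 / x) * exp (- (1 / x))) has_real_derivative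
      poly (monom 1 2 * (q - pderiv q)) (1 / x) * exp (- (1 / x))) (at x)"
    using greater
    by (auto intro!: derivative_eq_intros simp: poly_monom power2_eq_square field_simps)
  then have "(flat q has_real_derivative poly (monom 1 2 * (q - pderiv q)) (1 / x) * exp (- (1 / x))) (at x)"
    by (rule has_field_derivative_transform_within_open[of _ _ _ "{0<..}"]) (use greater in \<open>auto simp: flat_def\<close>)
  then show ?thesis using greater by (simp add: flat_def)
next
  case equal
  have "((\<lambda>y. poly (pCons 0 q) y * exp (- y)) \<longlongrightarrow> 0) at_top"
    by (rule poly_exp_minus_at_top)
  then have "((\<lambda>h. poly (pCons 0 q) (inverse h) * exp (- inverse h)) \<longlongrightarrow> 0) (at_right 0)"
    by (rule filterlim_compose[OF _ filterlim_inverse_at_top_right])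
  moreover have "eventually (\<lambda>h. poly (pCons 0 q) (inverse h) * exp (- inverse h) = flat q h / h) (at_right (0::real))"
    unfolding eventually_at_filter by (rule always_eventually) (simp add: flat_def field_simps)
  ultimately have "((\<lambda>h. flat q h / h) \<longlongrightarrow> 0) (at_right 0)"
    by (rule Lim_transform_eventually)
  moreover have "((\<lambda>h. flat q h / h) \<longlongrightarrow> 0) (at_left 0)"
    by (rule tendsto_eventually) (simp add: eventually_at_filter flat_def)
  ultimately have "((\<lambda>h. flat q h / h) \<longlongrightarrow> 0) (at 0)"
    by (simp add: filterlim_at_split)
  then show ?thesis using equal by (simp add: DERIV_def flat_def)
qed

text \<open>On (-1, 1) this equals exp (-2 / (1 - x^2)). The arguments are spelt as a * x + b to
  match \<open>diff_times_affine\<close>.\<close>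

definition bump :: "real \<Rightarrow> real"
  where "bump x = flat 1 ((-1) * x + 1) * flat 1 (1 * x + 1)"

lemma diff_times_bump: "diff_times n bump"
proof -
  have "diff_times n (flat 1)"
    by (rule diff_times_coinduct[of _ "range flat"]) (auto intro: flat_has_real_derivative)
  then show ?thesis
    unfolding bump_def[abs_def] by (intro diff_times_mult diff_times_affine)
qed

lemma bump_0: "bump 0 > 0"
  by (simp add: bump_def flat_def)

lemma bump_eq_0: "1 < \<bar>x\<bar> \<Longrightarrow> bump x = 0"
  by (auto simp: bump_def flat_def)

lemma test_fun_bump: "test_fun bump"
  unfolding test_fun_iff using diff_times_bump bump_eq_0 by blast

lemma test_fun_deriv:
  assumes "test_fun \<phi>" shows "test_fun (deriv \<phi>)"
proof -
  from assms obtain R where R: "\<And>x. R < \<bar>x\<bar> \<Longrightarrow> \<phi> x = 0" by (auto simp: test_fun_def)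
  have "deriv \<phi> x = 0" if "R < \<bar>x\<bar>" for x
  proof -
    have "((\<lambda>x. 0) has_real_derivative 0) (at x)" by simp
    moreover have "open {x :: real. R < \<bar>x\<bar>}" by (intro open_Collect_less continuous_intros)
    ultimately have "(\<phi> has_real_derivative 0) (at x)"
      by (rule has_field_derivative_transform_within_open) (use that R in auto)
    then show ?thesis by (rule DERIV_imp_deriv)
  qed
  moreover have "diff_times n (deriv \<phi>)" for n
    using assms unfolding test_fun_iff by (metis diff_times.simps(2))
  ultimately show ?thesis unfolding test_fun_iff by blast
qed

lemma test_fun_has_real_derivative:
  assumes "test_fun \<phi>" shows "(\<phi> has_real_derivative deriv \<phi> x) (at x)"
  using assms unfolding test_fun_def by (intro deriv_has_real_derivative) (metis funpow_0)

lemma test_fun_continuous: "test_fun \<phi> \<Longrightarrow> continuous_on A \<phi>"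
  by (meson DERIV_continuous_on has_field_derivative_at_within test_fun_has_real_derivative)

lemma test_fun_measurable: "test_fun \<phi> \<Longrightarrow> \<phi> \<in> borel_measurable borel"
  by (rule borel_measurable_continuous_onI[OF test_fun_continuous])

lemma test_fun_bounded:
  assumes "test_fun \<phi>" obtains B where "\<And>x. \<bar>\<phi> x\<bar> \<le> B"
proof -
  from assms obtain R where R: "\<And>x. R < \<bar>x\<bar> \<Longrightarrow> \<phi> x = 0" by (auto simp: test_fun_def)
  have "compact (\<phi> ` {-R..R})"
    by (intro compact_continuous_image test_fun_continuous assms) simp
  then obtain B where B: "\<And>x. x \<in> {-R..R} \<Longrightarrow> \<bar>\<phi> x\<bar> \<le> B"
    using compact_imp_bounded bounded_iff by (metis imageI real_norm_def)
  have "\<bar>\<phi> x\<bar> \<le> max B 0" for x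
    using B[of x] R[of x] by (cases "R < \<bar>x\<bar>") (auto simp: abs_le_iff not_less)
  then show ?thesis by (rule that)
qed

lemma test_fun_L2:
  assumes "test_fun \<phi>" shows "L2 (\<lambda>x. complex_of_real (\<phi> x))"
proof -
  from assms obtain R where R: "\<And>x. R < \<bar>x\<bar> \<Longrightarrow> \<phi> x = 0" by (auto simp: test_fun_def)
  obtain B where B: "\<And>x. \<bar>\<phi> x\<bar> \<le> B" using test_fun_bounded[OF assms] by blast
  note [measurable] = test_fun_measurable[OF assms]
  have int: "integrable lborel (\<lambda>x. B\<^sup>2 * indicator {-R..R} x)"
    by (intro integrable_mult_right integrable_real_indicator) (auto simp: emeasure_lborel_Icc_eq)
  have bd: "(cmod (complex_of_real (\<phi> x)))\<^sup>2 \<le> B\<^sup>2 * indicator {-R..R} x" for x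
    using R[of x] power_mono[OF B[of x], of 2] by (cases "R < \<bar>x\<bar>") (auto simp: indicator_def abs_le_iff not_less)
  show ?thesis by (rule L2_bound[OF _ int bd]) simp
qed

section \<open>Weak derivatives of Gaussian polynomials and of their limits\<close>

lemma weak_deriv1_gp:
  assumes "c > 0" shows "weak_deriv1 (gp c p) (gp c (gp_D c p))"
  unfolding weak_deriv1_def
proof (intro allI impI)
  fix \<phi> assume \<phi>: "test_fun \<phi>"
  from \<phi> obtain R where R: "\<And>x. R < \<bar>x\<bar> \<Longrightarrow> \<phi> x = 0" by (auto simp: test_fun_def)
  note [simp] = L2_mult_integrable L2_gp[OF assms] test_fun_L2[OF \<phi>] test_fun_L2[OF test_fun_deriv[OF \<phi>]]
  have ev: "(\<lambda>n. gp c p (s n) * complex_of_real (\<phi> (s n))) \<longlonglongrightarrow> 0" if "\<And>n. \<bar>s n\<bar> = real n" for s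
  proof (rule tendsto_eventually)
    obtain N :: nat where "R < real N" using reals_Archimedean2 by blast
    then have "\<phi> (s n) = 0" if "n \<ge> N" for n
      using R[of "s n"] that \<open>\<And>n. \<bar>s n\<bar> = real n\<close>[of n] by (simp add: order_less_le_trans)
    then show "eventually (\<lambda>n. gp c p (s n) * complex_of_real (\<phi> (s n)) = 0) sequentially"
      by (auto simp: eventually_sequentially)
  qed
  have "(LINT x|lborel. gp c p x * of_real (deriv \<phi> x) + gp c (gp_D c p) x * of_real (\<phi> x)) = 0"
  proof (rule integral_vector_derivative_eq_0[where W = "\<lambda>x. gp c p x * of_real (\<phi> x)"])
    fix x
    have "((\<lambda>x. complex_of_real (\<phi> x)) has_vector_derivative of_real (deriv \<phi> x)) (at x)"
      by (rule has_vector_derivative_of_real[OF test_fun_has_real_derivative[OF \<phi>]])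
    from has_vector_derivative_mult[OF gp_has_vector_derivative this]
    show "((\<lambda>x. gp c p x * of_real (\<phi> x)) has_vector_derivative
      gp c p x * of_real (deriv \<phi> x) + gp c (gp_D c p) x * of_real (\<phi> x)) (at x)" .
  qed (use ev[of real] ev[of "\<lambda>n. - real n"] in
      \<open>auto intro!: continuous_intros continuous_on_gp test_fun_continuous \<phi> test_fun_deriv\<close>)
  then show "(LINT x|lborel. gp c p x * of_real (deriv \<phi> x)) = - (LINT x|lborel. gp c (gp_D c p) x * of_real (\<phi> x))"
    by (simp add: eq_neg_iff_add_eq_0)
qed

lemma weak_deriv2_iter:
  assumes "weak_deriv1 f g" "weak_deriv1 g h" shows "weak_deriv2 f h"
  using assms test_fun_deriv unfolding weak_deriv1_def weak_deriv2_def by (simp add: numeral_2_eq_2)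

lemma weak_deriv2_gp: "c > 0 \<Longrightarrow> weak_deriv2 (gp c p) (gp c (gp_D c (gp_D c p)))"
  by (rule weak_deriv2_iter[OF weak_deriv1_gp weak_deriv1_gp])

text \<open>Test functions and their derivatives lie in L2, so both sides of the defining identity
  converge by \<open>L2_lim_pairing\<close>: weak differentiation is a closed operation.\<close>

lemma weak_deriv1_lim:
  assumes "\<And>n. weak_deriv1 (F n) (F1 n)" "L2_lim F f" "L2_lim F1 f1"
  shows "weak_deriv1 f f1"
  unfolding weak_deriv1_def
proof (intro allI impI)
  fix \<phi> assume \<phi>: "test_fun \<phi>"
  have c1: "(\<lambda>n. LINT x|lborel. F n x * of_real (deriv \<phi> x)) \<longlonglongrightarrow> (LINT x|lborel. f x * of_real (deriv \<phi> x))"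
    by (intro L2_lim_pairing L2_lim_const test_fun_L2 test_fun_deriv \<phi> assms)
  have c2: "(\<lambda>n. - (LINT x|lborel. F1 n x * of_real (\<phi> x))) \<longlonglongrightarrow> - (LINT x|lborel. f1 x * of_real (\<phi> x))"
    by (intro tendsto_minus L2_lim_pairing L2_lim_const test_fun_L2 \<phi> assms)
  have eq: "(\<lambda>n. LINT x|lborel. F n x * of_real (deriv \<phi> x)) = (\<lambda>n. - (LINT x|lborel. F1 n x * of_real (\<phi> x)))"
    using assms(1) \<phi> by (simp add: weak_deriv1_def fun_eq_iff)
  from c1[unfolded eq] c2 show "(LINT x|lborel. f x * of_real (deriv \<phi> x)) = - (LINT x|lborel. f1 x * of_real (\<phi> x))"
    by (rule LIMSEQ_unique)
qed

lemma weak_deriv2_lim: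
  assumes "\<And>n. weak_deriv2 (F n) (F2 n)" "L2_lim F f" "L2_lim F2 f2"
  shows "weak_deriv2 f f2"
  unfolding weak_deriv2_def
proof (intro allI impI)
  fix \<phi> assume \<phi>: "test_fun \<phi>"
  have "test_fun ((deriv ^^ 2) \<phi>)" using \<phi> by (simp add: numeral_2_eq_2 test_fun_deriv)
  then have c1: "(\<lambda>n. LINT x|lborel. F n x * of_real ((deriv ^^ 2) \<phi> x)) \<longlonglongrightarrow> (LINT x|lborel. f x * of_real ((deriv ^^ 2) \<phi> x))"
    by (intro L2_lim_pairing L2_lim_const test_fun_L2 assms)
  have c2: "(\<lambda>n. LINT x|lborel. F2 n x * of_real (\<phi> x)) \<longlonglongrightarrow> (LINT x|lborel. f2 x * of_real (\<phi> x))"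
    by (intro L2_lim_pairing L2_lim_const test_fun_L2 \<phi> assms)
  have eq: "(\<lambda>n. LINT x|lborel. F n x * of_real ((deriv ^^ 2) \<phi> x)) = (\<lambda>n. LINT x|lborel. F2 n x * of_real (\<phi> x))"
    using assms(1) \<phi> by (simp add: weak_deriv2_def fun_eq_iff)
  from c1[unfolded eq] c2 show "(LINT x|lborel. f x * of_real ((deriv ^^ 2) \<phi> x)) = (LINT x|lborel. f2 x * of_real (\<phi> x))"
    by (rule LIMSEQ_unique)
qed

section \<open>Testing weak derivatives against Gaussian polynomials\<close>

lemma Re_gp_has_real_derivative:
  "((\<lambda>x. Re (gp c p x)) has_real_derivative Re (gp c (gp_D c p) x)) (at x)"
  unfolding has_real_derivative_iff_has_vector_derivative
  by (rule bounded_linear.has_vector_derivative[OF bounded_linear_Re gp_has_vector_derivative])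

lemma bump_has_real_derivative:
  "(bump has_real_derivative deriv bump x) (at x)"
  "(deriv bump has_real_derivative deriv (deriv bump) x) (at x)"
  using test_fun_has_real_derivative test_fun_bump test_fun_deriv by blast+

text \<open>Weak derivatives are tested only against real, compactly supported functions, so a
  Gaussian polynomial enters through its real part times a dilated bump.\<close>

lemma test_fun_cutoff:
  assumes "a > 0" shows "test_fun (\<lambda>x. Re (gp c p x) * bump (a * x))"
proof -
  have "diff_times n (\<lambda>x. Re (gp c p x))" for n
    by (rule diff_times_coinduct[of _ "range (\<lambda>p x. Re (gp c p x))"]) (auto intro: Re_gp_has_real_derivative)
  moreover have "diff_times n (\<lambda>x. bump (a * x + 0))" for n
    by (rule diff_times_affine[OF diff_times_bump])
  ultimately have "diff_times n (\<lambda>x. Re (gp c p x) * bump (a * x))" for n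
    using diff_times_mult by fastforce
  moreover have "Re (gp c p x) * bump (a * x) = 0" if "1 / a < \<bar>x\<bar>" for x
  proof -
    have "1 < \<bar>a * x\<bar>" using that assms by (simp add: field_simps abs_mult)
    then show ?thesis by (simp add: bump_eq_0)
  qed
  ultimately show ?thesis unfolding test_fun_iff by blast
qed

lemma bump_scaled_has_real_derivative:
  "((\<lambda>x. bump (a * x)) has_real_derivative a * deriv bump (a * x)) (at x)"
  "((\<lambda>x. deriv bump (a * x)) has_real_derivative a * deriv (deriv bump) (a * x)) (at x)"
  by (rule DERIV_chain2[OF bump_has_real_derivative(1), THEN DERIV_cong]
      DERIV_chain2[OF bump_has_real_derivative(2), THEN DERIV_cong],
      auto intro!: derivative_eq_intros)+

lemma deriv_cutoff:
  "deriv (\<lambda>x. Re (gp c p x) * bump (a * x))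
    = (\<lambda>x. Re (gp c (gp_D c p) x) * bump (a * x) + a * (Re (gp c p x) * deriv bump (a * x)))"
  by (intro ext DERIV_imp_deriv)
    ((rule Re_gp_has_real_derivative bump_scaled_has_real_derivative derivative_eq_intros refl)+, simp add: algebra_simps)

lemma deriv2_cutoff:
  "(deriv ^^ 2) (\<lambda>x. Re (gp c p x) * bump (a * x))
    = (\<lambda>x. Re (gp c (gp_D c (gp_D c p)) x) * bump (a * x) + 2 * a * (Re (gp c (gp_D c p) x) * deriv bump (a * x))
        + a\<^sup>2 * (Re (gp c p x) * deriv (deriv bump) (a * x)))"
  unfolding numeral_2_eq_2 funpow.simps comp_def id_def deriv_cutoff
  by (intro ext DERIV_imp_deriv)
    ((rule Re_gp_has_real_derivative bump_scaled_has_real_derivative derivative_eq_intros refl)+,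
      simp add: power2_eq_square algebra_simps)

text \<open>The sequence k and the function b are bounded, which gives the majorant, and b (a n * x)
  tends to b 0 by continuity. The coefficient k n covers the factors a n and (a n)^2 that the
  product rule produces.\<close>

lemma L2_lim_cutoff:
  assumes c: "c > 0" and b: "test_fun b" and a: "a \<longlonglongrightarrow> 0" and k: "k \<longlonglongrightarrow> k0"
  shows "L2_lim (\<lambda>n x. complex_of_real (k n * (Re (gp c p x) * b (a n * x))))
    (\<lambda>x. complex_of_real (k0 * (Re (gp c p x) * b 0)))"
proof -
  obtain B where B: "\<And>x. \<bar>b x\<bar> \<le> B" using test_fun_bounded[OF b] by blast
  obtain K where K: "\<And>n. \<bar>k n\<bar> \<le> K"
    using convergent_imp_Bseq[OF convergentI[OF k]] by (auto simp: Bseq_def)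
  note [measurable] = test_fun_measurable[OF b]
  show ?thesis
  proof (rule L2_dominated_lim[where g = "\<lambda>x. complex_of_real (K * B) * gp c p x"])
    show "L2 (\<lambda>x. complex_of_real (K * B) * gp c p x)" by (intro L2_scale L2_gp c)
    show "cmod (complex_of_real (k n * (Re (gp c p x) * b (a n * x)))) \<le> cmod (complex_of_real (K * B) * gp c p x)" for n x
    proof -
      have KB: "0 \<le> K" "0 \<le> B" using order_trans[OF abs_ge_zero K] order_trans[OF abs_ge_zero B] by blast+
      have "\<bar>k n\<bar> * (\<bar>Re (gp c p x)\<bar> * \<bar>b (a n * x)\<bar>) \<le> K * (cmod (gp c p x) * B)"
        using KB by (intro mult_mono K B abs_Re_le_cmod) auto
      then show ?thesis using KB by (simp add: norm_mult abs_mult mult_ac)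
    qed
    have "isCont b 0"
      using test_fun_continuous[OF b, of UNIV] by (simp add: continuous_on_eq_continuous_at)
    moreover have "(\<lambda>n. a n * x) \<longlonglongrightarrow> 0" for x using tendsto_mult_right[OF a, of x] by simp
    ultimately have "(\<lambda>n. b (a n * x)) \<longlonglongrightarrow> b 0" for x
      by (rule isCont_tendsto_compose)
    then show "AE x in lborel. (\<lambda>n. complex_of_real (k n * (Re (gp c p x) * b (a n * x))))
        \<longlonglongrightarrow> complex_of_real (k0 * (Re (gp c p x) * b 0))"
      by (intro AE_I2 tendsto_intros k)
  qed measurable
qed

text \<open>The imaginary part of a Gaussian polynomial is the real part of the one with polynomial
  -i p, so real test functions suffice.\<close>

lemma gp_Re_decompose: "gp c p x = complex_of_real (Re (gp c p x)) + \<i> * complex_of_real (Re (gp c (smult (- \<i>) p) x))"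
  by (simp add: gp_smult complex_eq_iff del: smult_minus_left)

lemma gp_D_smult: "gp_D c (smult a p) = smult a (gp_D c p)"
  by (simp add: gp_D_def pderiv_smult smult_diff_right mult.commute)

lemma integral_gp_Re_decompose:
  assumes "c > 0" "L2 f"
  shows "(LINT x|lborel. f x * gp c p x) = (LINT x|lborel. f x * complex_of_real (Re (gp c p x)))
    + \<i> * (LINT x|lborel. f x * complex_of_real (Re (gp c (smult (- \<i>) p) x)))"
proof -
  have L: "L2 (\<lambda>x. complex_of_real (Re (gp c p x)))" for p
  proof (rule L2_bound[OF _ L2_integrable[OF L2_gp[OF assms(1), of p]]])
    show "(cmod (complex_of_real (Re (gp c p x))))\<^sup>2 \<le> (cmod (gp c p x))\<^sup>2" for x
      unfolding norm_of_real by (rule power_mono[OF abs_Re_le_cmod]) simp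
  qed simp
  have "f x * gp c p x = f x * complex_of_real (Re (gp c p x))
     + \<i> * (f x * complex_of_real (Re (gp c (smult (- \<i>) p) x)))" for x
    by (subst gp_Re_decompose) (simp only: distrib_left mult.left_commute)
  then have "(LINT x|lborel. f x * gp c p x) = (LINT x|lborel. f x * complex_of_real (Re (gp c p x))
     + \<i> * (f x * complex_of_real (Re (gp c (smult (- \<i>) p) x))))"
    by (simp only:)
  also have "\<dots> = (LINT x|lborel. f x * complex_of_real (Re (gp c p x)))
    + \<i> * (LINT x|lborel. f x * complex_of_real (Re (gp c (smult (- \<i>) p) x)))"
    by (simp add: L2_mult_integrable[OF assms(2) L] del: smult_minus_left)
  finally show ?thesis .
qed

text \<open>Remove the cutoff by letting its width tend to infinity. The product rule term with the
  derivative of the bump carries the factor \<open>a n\<close> and vanishes in L2, which is enough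
  because f and f1 are in L2.\<close>

lemma weak_deriv1_gp_test:
  assumes c: "c > 0" and w: "weak_deriv1 f f1" and L: "L2 f" "L2 f1"
  shows "(LINT x|lborel. f x * gp c (gp_D c p) x) = - (LINT x|lborel. f1 x * gp c p x)"
proof -
  define a where "a = (\<lambda>n. 1 / real (Suc n))"
  have a: "a \<longlonglongrightarrow> 0" unfolding a_def by (rule LIMSEQ_Suc[OF lim_1_over_n])
  have a0: "a n > 0" for n by (simp add: a_def)
  note tf = test_fun_bump test_fun_deriv[OF test_fun_bump]
  have real: "(LINT x|lborel. f x * complex_of_real (Re (gp c (gp_D c p) x)))
     = - (LINT x|lborel. f1 x * complex_of_real (Re (gp c p x)))" for p
  proof -
    define \<phi> where "\<phi> = (\<lambda>n x. Re (gp c p x) * bump (a n * x))"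
    have "L2_lim (\<lambda>n x. complex_of_real (1 * (Re (gp c (gp_D c p) x) * bump (a n * x)))
          + complex_of_real (a n * (Re (gp c p x) * deriv bump (a n * x))))
        (\<lambda>x. complex_of_real (1 * (Re (gp c (gp_D c p) x) * bump 0))
          + complex_of_real (0 * (Re (gp c p x) * deriv bump 0)))"
      by (intro L2_lim_add L2_lim_cutoff c a tf tendsto_const)
    then have "L2_lim (\<lambda>n x. complex_of_real (deriv (\<phi> n) x)) (\<lambda>x. complex_of_real (Re (gp c (gp_D c p) x) * bump 0))"
      unfolding \<phi>_def deriv_cutoff by simp
    from L2_lim_pairing[OF L2_lim_const[OF L(1)] this]
    have 1: "(\<lambda>n. LINT x|lborel. f x * complex_of_real (deriv (\<phi> n) x))
      \<longlonglongrightarrow> (LINT x|lborel. f x * complex_of_real (Re (gp c (gp_D c p) x) * bump 0))" .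
    have "L2_lim (\<lambda>n x. complex_of_real (1 * (Re (gp c p x) * bump (a n * x))))
        (\<lambda>x. complex_of_real (1 * (Re (gp c p x) * bump 0)))"
      by (intro L2_lim_cutoff c a tf tendsto_const)
    then have "L2_lim (\<lambda>n x. complex_of_real (\<phi> n x)) (\<lambda>x. complex_of_real (Re (gp c p x) * bump 0))"
      unfolding \<phi>_def by simp
    from tendsto_minus[OF L2_lim_pairing[OF L2_lim_const[OF L(2)] this]]
    have 2: "(\<lambda>n. - (LINT x|lborel. f1 x * complex_of_real (\<phi> n x)))
      \<longlonglongrightarrow> - (LINT x|lborel. f1 x * complex_of_real (Re (gp c p x) * bump 0))" .
    have eq: "(\<lambda>n. LINT x|lborel. f x * complex_of_real (deriv (\<phi> n) x)) = (\<lambda>n. - (LINT x|lborel. f1 x * complex_of_real (\<phi> n x)))"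
      using w test_fun_cutoff[OF a0] by (auto simp: weak_deriv1_def \<phi>_def)
    from 1[unfolded eq] 2 have "(LINT x|lborel. f x * complex_of_real (Re (gp c (gp_D c p) x) * bump 0))
       = - (LINT x|lborel. f1 x * complex_of_real (Re (gp c p x) * bump 0))"
      by (rule LIMSEQ_unique)
    then have "(LINT x|lborel. f x * complex_of_real (Re (gp c (gp_D c p) x))) * complex_of_real (bump 0)
       = (- (LINT x|lborel. f1 x * complex_of_real (Re (gp c p x)))) * complex_of_real (bump 0)"
      by (simp flip: mult.assoc)
    \<comment> \<open>The bump is not normalised: its value at 0 is merely positive, and it is
      cancelled from both sides.\<close>
    then show ?thesis using bump_0 unfolding mult_cancel_right by simp
  qed
  show ?thesis
    unfolding integral_gp_Re_decompose[OF c L(1)] integral_gp_Re_decompose[OF c L(2)]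
    unfolding gp_D_smult[symmetric] real by simp
qed

text \<open>As for the first derivative, now with two extra terms from the product rule, carrying
  the vanishing factors \<open>2 * a n\<close> and \<open>(a n)\<^sup>2\<close>.\<close>

lemma weak_deriv2_gp_test:
  assumes c: "c > 0" and w: "weak_deriv2 f f2" and L: "L2 f" "L2 f2"
  shows "(LINT x|lborel. f x * gp c (gp_D c (gp_D c p)) x) = (LINT x|lborel. f2 x * gp c p x)"
proof -
  define a where "a = (\<lambda>n. 1 / real (Suc n))"
  have a: "a \<longlonglongrightarrow> 0" unfolding a_def by (rule LIMSEQ_Suc[OF lim_1_over_n])
  have a1: "(\<lambda>n. 2 * a n) \<longlonglongrightarrow> 2 * 0" "(\<lambda>n. (a n)\<^sup>2) \<longlonglongrightarrow> 0\<^sup>2"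
    by (intro tendsto_intros a)+
  have a0: "a n > 0" for n by (simp add: a_def)
  note tf = test_fun_bump test_fun_deriv[OF test_fun_bump] test_fun_deriv[OF test_fun_deriv[OF test_fun_bump]]
  have real: "(LINT x|lborel. f x * complex_of_real (Re (gp c (gp_D c (gp_D c p)) x)))
     = (LINT x|lborel. f2 x * complex_of_real (Re (gp c p x)))" for p
  proof -
    define \<phi> where "\<phi> = (\<lambda>n x. Re (gp c p x) * bump (a n * x))"
    have "L2_lim (\<lambda>n x. complex_of_real (1 * (Re (gp c (gp_D c (gp_D c p)) x) * bump (a n * x)))
          + complex_of_real (2 * a n * (Re (gp c (gp_D c p) x) * deriv bump (a n * x)))
          + complex_of_real ((a n)\<^sup>2 * (Re (gp c p x) * deriv (deriv bump) (a n * x))))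
        (\<lambda>x. complex_of_real (1 * (Re (gp c (gp_D c (gp_D c p)) x) * bump 0))
          + complex_of_real (2 * 0 * (Re (gp c (gp_D c p) x) * deriv bump 0))
          + complex_of_real (0\<^sup>2 * (Re (gp c p x) * deriv (deriv bump) 0)))"
      by (intro L2_lim_add L2_lim_cutoff c a a1 tf tendsto_const)
    then have "L2_lim (\<lambda>n x. complex_of_real ((deriv ^^ 2) (\<phi> n) x)) (\<lambda>x. complex_of_real (Re (gp c (gp_D c (gp_D c p)) x) * bump 0))"
      unfolding \<phi>_def deriv2_cutoff by simp
    from L2_lim_pairing[OF L2_lim_const[OF L(1)] this]
    have 1: "(\<lambda>n. LINT x|lborel. f x * complex_of_real ((deriv ^^ 2) (\<phi> n) x))
      \<longlonglongrightarrow> (LINT x|lborel. f x * complex_of_real (Re (gp c (gp_D c (gp_D c p)) x) * bump 0))" .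
    have "L2_lim (\<lambda>n x. complex_of_real (1 * (Re (gp c p x) * bump (a n * x))))
        (\<lambda>x. complex_of_real (1 * (Re (gp c p x) * bump 0)))"
      by (intro L2_lim_cutoff c a tf tendsto_const)
    then have "L2_lim (\<lambda>n x. complex_of_real (\<phi> n x)) (\<lambda>x. complex_of_real (Re (gp c p x) * bump 0))"
      unfolding \<phi>_def by simp
    from L2_lim_pairing[OF L2_lim_const[OF L(2)] this]
    have 2: "(\<lambda>n. LINT x|lborel. f2 x * complex_of_real (\<phi> n x))
      \<longlonglongrightarrow> (LINT x|lborel. f2 x * complex_of_real (Re (gp c p x) * bump 0))" .
    have eq: "(\<lambda>n. LINT x|lborel. f x * complex_of_real ((deriv ^^ 2) (\<phi> n) x)) = (\<lambda>n. LINT x|lborel. f2 x * complex_of_real (\<phi> n x))"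
      using w test_fun_cutoff[OF a0] by (auto simp: weak_deriv2_def \<phi>_def)
    from 1[unfolded eq] 2 have "(LINT x|lborel. f x * complex_of_real (Re (gp c (gp_D c (gp_D c p)) x) * bump 0))
       = (LINT x|lborel. f2 x * complex_of_real (Re (gp c p x) * bump 0))"
      by (rule LIMSEQ_unique)
    then show ?thesis using bump_0 by (simp flip: mult.assoc)
  qed
  show ?thesis
    unfolding integral_gp_Re_decompose[OF c L(1)] integral_gp_Re_decompose[OF c L(2)]
    unfolding gp_D_smult[symmetric] real by simp
qed

section \<open>The oscillator\<close>


text \<open>The derivatives are separate arguments, so the same expression applies to classical
  derivatives of Gaussian polynomials and to chosen representatives of weak derivatives.\<close>

definition osc :: "real \<Rightarrow> (real \<Rightarrow> complex) \<Rightarrow> (real \<Rightarrow> complex) \<Rightarrow> (real \<Rightarrow> complex) \<Rightarrow> real \<Rightarrow> complex"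
  where "osc \<gamma> u u1 u2 x = - (1/4) * u2 x + complex_of_real (x\<^sup>2) * u x
    - complex_of_real \<gamma> * (u x / 2 + complex_of_real x * u1 x)"

text \<open>Approximation in a norm strong enough to control each term of H on its own. It does not
  mention \<gamma>, and its last two conditions contain the square integrability of x^2 u and x
  u1.\<close>

definition graph_lim ::
    "real \<Rightarrow> (nat \<Rightarrow> complex poly) \<Rightarrow> (real \<Rightarrow> complex) \<Rightarrow> (real \<Rightarrow> complex) \<Rightarrow> (real \<Rightarrow> complex) \<Rightarrow> bool"
  where "graph_lim c P u u1 u2 \<longleftrightarrow>
    L2_lim (\<lambda>n. gp c (P n)) u \<and> L2_lim (\<lambda>n. gp c (gp_D c (P n))) u1 \<and>
    L2_lim (\<lambda>n. gp c (gp_D c (gp_D c (P n)))) u2 \<and>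
    L2_lim (\<lambda>n. gp c (pCons 0 (pCons 0 (P n)))) (\<lambda>x. complex_of_real (x\<^sup>2) * u x) \<and>
    L2_lim (\<lambda>n. gp c (pCons 0 (gp_D c (P n)))) (\<lambda>x. complex_of_real x * u1 x)"

lemma gp_D_diff: "gp_D c (p - q) = gp_D c p - gp_D c q"
  by (simp add: gp_D_def pderiv_diff smult_diff_right flip: diff_pCons)

lemma pCons_0_diff: "pCons 0 (p - q) = pCons 0 p - pCons 0 (q :: complex poly)"
  by simp

lemma gp_H_diff: "gp_H \<gamma> c (p - q) = gp_H \<gamma> c p - gp_H \<gamma> c q"
  unfolding gp_H_def gp_D_diff pCons_0_diff smult_diff_right smult_add_right by (simp add: algebra_simps)

lemma gp_H_osc: "gp c (gp_H \<gamma> c p) x = osc \<gamma> (gp c p) (gp c (gp_D c p)) (gp c (gp_D c (gp_D c p))) x"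
  by (simp only: gp_H_eq osc_def)

lemma graph_lim_weak_deriv:
  assumes "c > 0" "graph_lim c P u u1 u2"
  shows "weak_deriv1 u u1" "weak_deriv2 u u2"
proof -
  show "weak_deriv1 u u1"
    by (rule weak_deriv1_lim[of "\<lambda>n. gp c (P n)" "\<lambda>n. gp c (gp_D c (P n))"])
      (use assms in \<open>simp_all add: graph_lim_def weak_deriv1_gp\<close>)
  show "weak_deriv2 u u2"
    by (rule weak_deriv2_lim[of "\<lambda>n. gp c (P n)" "\<lambda>n. gp c (gp_D c (gp_D c (P n)))"])
      (use assms in \<open>simp_all add: graph_lim_def weak_deriv2_gp\<close>)
qed

lemma graph_lim_L2:
  assumes "graph_lim c P u u1 u2"
  shows "L2 u" "L2 u1" "L2 u2" "L2 (\<lambda>x. complex_of_real (x\<^sup>2) * u x)"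
  using assms by (auto simp: graph_lim_def L2_lim_def)

text \<open>Each term of the operator converges separately, so \<gamma> and the exponent c need not
  be related. This lets approximations found for \<gamma> = 0 serve every \<gamma>.\<close>

lemma graph_lim_osc:
  assumes "graph_lim c P u u1 u2"
  shows "L2_lim (\<lambda>n. gp c (gp_H \<gamma> c (P n))) (osc \<gamma> u u1 u2)"
proof -
  have "L2_lim (\<lambda>n x. - (1/4) * gp c (gp_D c (gp_D c (P n))) x + gp c (pCons 0 (pCons 0 (P n))) x
      - complex_of_real \<gamma> * (1/2 * gp c (P n) x + gp c (pCons 0 (gp_D c (P n))) x))
    (\<lambda>x. - (1/4) * u2 x + complex_of_real (x\<^sup>2) * u x
      - complex_of_real \<gamma> * (1/2 * u x + complex_of_real x * u1 x))"
    using assms unfolding graph_lim_def by (intro L2_lim_add L2_lim_diff L2_lim_scale) blast+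
  moreover have "gp c (gp_H \<gamma> c (P n)) = (\<lambda>x. - (1/4) * gp c (gp_D c (gp_D c (P n))) x
      + gp c (pCons 0 (pCons 0 (P n))) x
      - complex_of_real \<gamma> * (1/2 * gp c (P n) x + gp c (pCons 0 (gp_D c (P n))) x))" for n
    by (rule ext) (simp add: gp_H_eq gp_pCons_0 power2_eq_square)
  moreover have "osc \<gamma> u u1 u2 = (\<lambda>x. - (1/4) * u2 x + complex_of_real (x\<^sup>2) * u x
      - complex_of_real \<gamma> * (1/2 * u x + complex_of_real x * u1 x))"
    by (rule ext) (simp add: osc_def)
  ultimately show ?thesis by (simp only:)
qed

lemma graph_lim_accretive:
  assumes "c > 0" "graph_lim c P u u1 u2"
  shows "Re (LINT x|lborel. osc \<gamma> u u1 u2 x * cnj (u x)) \<ge> 0"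
proof (rule tendsto_lowerbound)
  show "(\<lambda>n. Re (LINT x|lborel. gp c (gp_H \<gamma> c (P n)) x * cnj (gp c (P n) x)))
      \<longlonglongrightarrow> Re (LINT x|lborel. osc \<gamma> u u1 u2 x * cnj (u x))"
    by (intro tendsto_Re L2_lim_pairing graph_lim_osc[OF assms(2)] L2_lim_cnj)
      (use assms(2) in \<open>simp add: graph_lim_def\<close>)
  have "0 \<le> Re (LINT x|lborel. gp c (gp_H \<gamma> c (P n)) x * cnj (gp c (P n) x))" for n
    unfolding gp_energy[OF assms(1)] by (simp add: sqn_nonneg)
  then show "\<forall>\<^sub>F n in sequentially. 0 \<le> Re (LINT x|lborel. gp c (gp_H \<gamma> c (P n)) x * cnj (gp c (P n) x))"
    by (rule always_eventually[OF allI])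
qed simp

text \<open>Approximate f by Gaussian polynomials with a geometric rate, solve exactly for each of
  them, and let \<open>gp_graph_estimate\<close> pass the rate on to the solutions. Pointwise limits
  identify the weighted functions and verify the equation almost everywhere.\<close>

lemma resolvent_solution:
  assumes c: "c > 0" "c\<^sup>2 = 1 + 2 * c * \<gamma>" and \<gamma>: "\<bar>\<gamma>\<bar> \<le> 1" and z: "Re z < 0" and f: "L2 f"
  obtains P u u1 u2 where "graph_lim c P u u1 u2" "AE x in lborel. osc \<gamma> u u1 u2 x - z * u x = f x"
proof -
  have "\<exists>p. sqn (\<lambda>x. f x - gp c (gp_H \<gamma> c p - smult z p) x) < 1 / 4 ^ n" for n
  proof -
    obtain q where q: "sqn (\<lambda>x. f x - gp c q x) < 1 / 4 ^ n"
      using gp_dense[OF c(1) f, of "1 / 4 ^ n"] by auto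
    obtain p where "gp_H \<gamma> c p - smult z p = q" using gp_H_onto[OF c z] by blast
    with q show ?thesis by blast
  qed
  then obtain P where P: "\<And>n. sqn (\<lambda>x. f x - gp c (gp_H \<gamma> c (P n) - smult z (P n)) x) < 1 / 4 ^ n"
    by metis
  define Q where "Q = (\<lambda>n. gp_H \<gamma> c (P n) - smult z (P n))"
  note [simp] = L2_gp[OF c(1)]
  have Qstep: "sqn (gp c (Q (Suc n) - Q n)) \<le> 4 / 4 ^ n" for n
  proof -
    have "sqn (\<lambda>x. (f x - gp c (Q n) x) - (f x - gp c (Q (Suc n)) x))
        \<le> 2 * sqn (\<lambda>x. f x - gp c (Q n) x) + 2 * sqn (\<lambda>x. f x - gp c (Q (Suc n)) x)"
      by (intro sqn_diff_le L2_diff f) simp_all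
    moreover have "(\<lambda>x. (f x - gp c (Q n) x) - (f x - gp c (Q (Suc n)) x)) = gp c (Q (Suc n) - Q n)"
      by (simp add: fun_eq_iff gp_diff)
    moreover have "1 / 4 ^ Suc n \<le> (1 :: real) / 4 ^ n" by (simp add: divide_simps)
    ultimately show ?thesis using P[of n] P[of "Suc n"] by (simp add: Q_def)
  qed
  obtain K where K: "\<And>p. max (sqn (gp c p)) (max (sqn (gp c (gp_D c p))) (max (sqn (gp c (gp_D c (gp_D c p))))
      (max (sqn (gp c (pCons 0 (pCons 0 p)))) (sqn (gp c (pCons 0 (gp_D c p)))))))
    \<le> K * sqn (gp c (gp_H \<gamma> c p - smult z p))"
    using gp_graph_estimate[OF c(1) \<gamma> z] by blast
  \<comment> \<open>K is not known to be nonnegative, hence the maximum; the factor 4 is that of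
    \<open>Qstep\<close>.\<close>
  define M where "M = max K 0 * 4"
  have est: "max (sqn (gp c p)) (max (sqn (gp c (gp_D c p))) (max (sqn (gp c (gp_D c (gp_D c p))))
      (max (sqn (gp c (pCons 0 (pCons 0 p)))) (sqn (gp c (pCons 0 (gp_D c p)))))))
    \<le> M / 4 ^ n" if p: "p = P (Suc n) - P n" for p n
  proof -
    have "gp_H \<gamma> c p - smult z p = Q (Suc n) - Q n"
      by (simp add: p Q_def gp_H_diff smult_diff_right)
    then have "K * sqn (gp c (gp_H \<gamma> c p - smult z p)) = K * sqn (gp c (Q (Suc n) - Q n))"
      by (simp only:)
    also have "\<dots> \<le> max K 0 * (4 / 4 ^ n)"
      by (intro mult_mono Qstep sqn_nonneg) auto
    also have "\<dots> = M / 4 ^ n" by (simp add: M_def)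
    finally show ?thesis using K[of p] by linarith
  qed
  \<comment> \<open>T stands for one of the five operations on polynomials in the estimate; by
    additivity the increments of T (P n) are T of the increments.\<close>
  have complete: "\<exists>v. L2_lim (\<lambda>n. gp c (T (P n))) v \<and> (AE x in lborel. (\<lambda>n. gp c (T (P n)) x) \<longlonglongrightarrow> v x)"
    if T: "\<And>p q. T (p - q) = T p - T q"
      and b: "\<And>n p. p = P (Suc n) - P n \<Longrightarrow> sqn (gp c (T p)) \<le> M / 4 ^ n" for T
  proof -
    have "sqn (\<lambda>x. gp c (T (P (Suc n))) x - gp c (T (P n)) x) \<le> M / 4 ^ n" for n
      using b[of _ n] by (simp add: T gp_diff[abs_def])
    from L2_complete[OF L2_gp[OF c(1)] this] show ?thesis by blast
  qed
  have "\<exists>v. L2_lim (\<lambda>n. gp c (P n)) v \<and> (AE x in lborel. (\<lambda>n. gp c (P n) x) \<longlonglongrightarrow> v x)"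
    by (rule complete[of "\<lambda>p. p"]) (use est in auto)
  then obtain u where u: "L2_lim (\<lambda>n. gp c (P n)) u" "AE x in lborel. (\<lambda>n. gp c (P n) x) \<longlonglongrightarrow> u x"
    by blast
  have "\<exists>v. L2_lim (\<lambda>n. gp c (gp_D c (P n))) v \<and> (AE x in lborel. (\<lambda>n. gp c (gp_D c (P n)) x) \<longlonglongrightarrow> v x)"
    by (rule complete) (use est in \<open>auto simp: gp_D_diff\<close>)
  then obtain u1 where u1: "L2_lim (\<lambda>n. gp c (gp_D c (P n))) u1"
    "AE x in lborel. (\<lambda>n. gp c (gp_D c (P n)) x) \<longlonglongrightarrow> u1 x" by blast
  have "\<exists>v. L2_lim (\<lambda>n. gp c (gp_D c (gp_D c (P n)))) v \<and> (AE x in lborel. (\<lambda>n. gp c (gp_D c (gp_D c (P n))) x) \<longlonglongrightarrow> v x)"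
    by (rule complete[of "\<lambda>p. gp_D c (gp_D c p)"]) (use est in \<open>auto simp: gp_D_diff\<close>)
  then obtain u2 where u2: "L2_lim (\<lambda>n. gp c (gp_D c (gp_D c (P n)))) u2"
    "AE x in lborel. (\<lambda>n. gp c (gp_D c (gp_D c (P n))) x) \<longlonglongrightarrow> u2 x" by blast
  have "\<exists>v. L2_lim (\<lambda>n. gp c (pCons 0 (pCons 0 (P n)))) v \<and> (AE x in lborel. (\<lambda>n. gp c (pCons 0 (pCons 0 (P n))) x) \<longlonglongrightarrow> v x)"
    by (rule complete[of "\<lambda>p. pCons 0 (pCons 0 p)"]) (use est in auto)
  then obtain v where v: "L2_lim (\<lambda>n. gp c (pCons 0 (pCons 0 (P n)))) v"
    "AE x in lborel. (\<lambda>n. gp c (pCons 0 (pCons 0 (P n))) x) \<longlonglongrightarrow> v x" by blast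
  have "\<exists>v. L2_lim (\<lambda>n. gp c (pCons 0 (gp_D c (P n)))) v \<and> (AE x in lborel. (\<lambda>n. gp c (pCons 0 (gp_D c (P n))) x) \<longlonglongrightarrow> v x)"
    by (rule complete[of "\<lambda>p. pCons 0 (gp_D c p)"]) (use est in \<open>auto simp: gp_D_diff\<close>)
  then obtain v1 where v1: "L2_lim (\<lambda>n. gp c (pCons 0 (gp_D c (P n)))) v1"
    "AE x in lborel. (\<lambda>n. gp c (pCons 0 (gp_D c (P n))) x) \<longlonglongrightarrow> v1 x" by blast
  have [measurable]: "u \<in> borel_measurable borel" "u1 \<in> borel_measurable borel"
    using u u1 by (auto simp: L2_lim_def dest: L2_measurable)
  \<comment> \<open>Multiplication by x^2 is unbounded on L2, so the limit of the weighted sequence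
    is identified by uniqueness of pointwise limits.\<close>
  have veq: "AE x in lborel. v x = complex_of_real (x\<^sup>2) * u x"
    using v(2) u(2)
  proof eventually_elim
    case (elim x)
    have "(\<lambda>n. complex_of_real (x\<^sup>2) * gp c (P n) x) \<longlonglongrightarrow> complex_of_real (x\<^sup>2) * u x"
      by (intro tendsto_intros elim)
    moreover have "complex_of_real (x\<^sup>2) * gp c (P n) x = gp c (pCons 0 (pCons 0 (P n))) x" for n
      by (simp add: gp_pCons_0 power2_eq_square)
    ultimately show ?case using LIMSEQ_unique[OF elim(1)] by simp
  qed
  have v1eq: "AE x in lborel. v1 x = complex_of_real x * u1 x"
    using v1(2) u1(2)
  proof eventually_elim
    case (elim x)
    have "(\<lambda>n. complex_of_real x * gp c (gp_D c (P n)) x) \<longlonglongrightarrow> complex_of_real x * u1 x"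
      by (intro tendsto_intros elim)
    then show ?case using LIMSEQ_unique[OF elim(1)] by (simp add: gp_pCons_0)
  qed
  have "graph_lim c P u u1 u2"
    unfolding graph_lim_def
    by (intro conjI u(1) u1(1) u2(1) L2_lim_AE_cong[OF v(1) _ veq] L2_lim_AE_cong[OF v1(1) _ v1eq]) measurable
  moreover have "AE x in lborel. (\<lambda>n. f x - gp c (Q n) x) \<longlonglongrightarrow> 0"
    by (rule AE_null_sequence[of _ 1]) (use P f in \<open>auto intro!: L2_diff less_imp_le simp: Q_def\<close>)
  then have "AE x in lborel. osc \<gamma> u u1 u2 x - z * u x = f x"
    using u(2) u1(2) u2(2)
  proof eventually_elim
    case (elim x)
    have "(\<lambda>n. f x - (f x - gp c (Q n) x)) \<longlonglongrightarrow> f x - 0"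
      by (intro tendsto_intros elim)
    then have l1: "(\<lambda>n. gp c (Q n) x) \<longlonglongrightarrow> f x" by simp
    have "(\<lambda>n. osc \<gamma> (gp c (P n)) (gp c (gp_D c (P n))) (gp c (gp_D c (gp_D c (P n)))) x - z * gp c (P n) x)
       \<longlonglongrightarrow> osc \<gamma> u u1 u2 x - z * u x"
      unfolding osc_def by (intro tendsto_intros elim) simp
    moreover have "osc \<gamma> (gp c (P n)) (gp c (gp_D c (P n))) (gp c (gp_D c (gp_D c (P n)))) x - z * gp c (P n) x
       = gp c (Q n) x" for n
      by (simp only: Q_def gp_diff gp_smult gp_H_osc)
    ultimately have "(\<lambda>n. gp c (Q n) x) \<longlonglongrightarrow> osc \<gamma> u u1 u2 x - z * u x" by simp
    from this l1 show ?case by (rule LIMSEQ_unique)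
  qed
  ultimately show ?thesis by (rule that)
qed

lemma AE_eq_if_gp_pairings_eq:
  assumes c: "c > 0" and L: "L2 f" "L2 g"
    and eq: "\<And>p. (LINT x|lborel. f x * gp c p x) = (LINT x|lborel. g x * gp c p x)"
  shows "AE x in lborel. f x = g x"
proof -
  have "AE x in lborel. f x - g x = 0"
  proof (rule AE_0_if_orthogonal_gp[OF c L2_diff[OF L]])
    show "(LINT x|lborel. (f x - g x) * gp c p x) = 0" for p
      using eq[of p] L by (simp add: left_diff_distrib L2_mult_integrable L2_gp[OF c])
  qed
  then show ?thesis by simp
qed

text \<open>At \<gamma> = 0 the only differential term is -v''/4, which
  \<open>weak_deriv2_gp_test\<close> moves onto the Gaussian polynomial; multiplications are
  symmetric. The pairing being bilinear, z is not conjugated.\<close>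

lemma harmonic_pairing:
  assumes c: "c > 0" and L: "L2 v" "L2 v2" "L2 (\<lambda>x. complex_of_real (x\<^sup>2) * v x)" and w: "weak_deriv2 v v2"
  shows "(LINT x|lborel. v x * gp c (gp_H 0 c p - smult z p) x)
    = (LINT x|lborel. (osc 0 v v1 v2 x - z * v x) * gp c p x)"
proof -
  note [simp] = L2_gp[OF c] L2_mult_integrable
  have 1: "v x * gp c (gp_H 0 c p - smult z p) x = - 1 / 4 * (v x * gp c (gp_D c (gp_D c p)) x)
     + ((complex_of_real (x\<^sup>2) * v x) * gp c p x - z * (v x * gp c p x))" for x
    by (simp add: gp_diff gp_smult gp_H_eq algebra_simps)
  have 2: "(osc 0 v v1 v2 x - z * v x) * gp c p x = - 1 / 4 * (v2 x * gp c p x)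
     + ((complex_of_real (x\<^sup>2) * v x) * gp c p x - z * (v x * gp c p x))" for x
    by (simp add: osc_def algebra_simps)
  have rest: "integrable lborel (\<lambda>x. (complex_of_real (x\<^sup>2) * v x) * gp c p x - z * (v x * gp c p x))"
    using L by (intro Bochner_Integration.integrable_diff integrable_mult_right L2_mult_integrable) simp_all
  show ?thesis
    unfolding 1 2
    using weak_deriv2_gp_test[OF c w L(1,2), of p] L rest
    by (subst (1 2) Bochner_Integration.integral_add) (simp_all del: of_real_power)
qed

text \<open>The oscillator with \<open>\<gamma> = 0\<close> is symmetric, so pairing against its range on Gaussian polynomials
  identifies an arbitrary domain element with the graph-norm limit produced by \<open>resolvent_solution\<close>;
  in particular \<open>x\<close> times the weak derivative is square integrable on the domain.\<close>

lemma gp_core: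
  assumes L: "L2 \<psi>" "L2 \<psi>1" "L2 \<psi>2" "L2 (\<lambda>x. complex_of_real (x\<^sup>2) * \<psi> x)"
    and w: "weak_deriv1 \<psi> \<psi>1" "weak_deriv2 \<psi> \<psi>2"
  obtains P where "graph_lim 1 P \<psi> \<psi>1 \<psi>2"
proof -
  \<comment> \<open>The spectral parameter is -1. Since \<gamma> = 0 removes the term x \<psi>1, the
    domain conditions already give f in L2.\<close>
  define f where "f = (\<lambda>x. osc 0 \<psi> \<psi>1 \<psi>2 x - (-1) * \<psi> x)"
  have "f = (\<lambda>x. - (1/4) * \<psi>2 x + complex_of_real (x\<^sup>2) * \<psi> x - (-1) * \<psi> x)"
    by (rule ext) (simp add: f_def osc_def)
  moreover have "L2 \<dots>" by (intro L2_add L2_diff L2_scale L)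
  ultimately have Lf: "L2 f" by simp
  \<comment> \<open>For \<gamma> = 0 the equation for the exponent reads c^2 = 1, hence c =
    1.\<close>
  obtain P u u1 u2 where u: "graph_lim 1 P u u1 u2" "AE x in lborel. osc 0 u u1 u2 x - (-1) * u x = f x"
    by (rule resolvent_solution[of 1 0 "-1" f]) (use Lf in simp_all)
  note Lu = graph_lim_L2[OF u(1)] and wu = graph_lim_weak_deriv[OF zero_less_one u(1)]
  note [measurable] = L2_measurable[OF Lu(1)] L2_measurable[OF Lu(2)] L2_measurable[OF Lu(3)]
    L2_measurable[OF L(1)] L2_measurable[OF L(2)] L2_measurable[OF L(3)] L2_measurable[OF Lf]
  have meas: "osc 0 u u1 u2 \<in> borel_measurable borel" unfolding osc_def[abs_def] by measurable
  have ae0: "AE x in lborel. u x = \<psi> x"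
  proof (rule AE_eq_if_gp_pairings_eq[OF zero_less_one Lu(1) L(1)])
    fix q
    \<comment> \<open>Every test polynomial lies in the range of the operator plus 1, so u and
      \<psi>, having the same image f, have the same pairings.\<close>
    obtain p where p: "gp_H 0 1 p - smult (-1) p = q" using gp_H_onto[of 1 0 "-1" q] by auto
    have "(LINT x|lborel. u x * gp 1 q x) = (LINT x|lborel. (osc 0 u u1 u2 x - (-1) * u x) * gp 1 p x)"
      unfolding p[symmetric] by (rule harmonic_pairing[OF zero_less_one Lu(1,3,4) wu(2)])
    also have "\<dots> = (LINT x|lborel. f x * gp 1 p x)"
    proof (rule integral_cong_AE)
      show "(\<lambda>x. (osc 0 u u1 u2 x - (-1) * u x) * gp 1 p x) \<in> borel_measurable lborel"
        using meas by measurable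
      show "AE x in lborel. (osc 0 u u1 u2 x - (-1) * u x) * gp 1 p x = f x * gp 1 p x"
        using u(2) by eventually_elim (simp only:)
    qed measurable
    also have "\<dots> = (LINT x|lborel. \<psi> x * gp 1 q x)"
      unfolding p[symmetric] f_def by (rule harmonic_pairing[OF zero_less_one L(1,3,4) w(2), symmetric])
    finally show "(LINT x|lborel. u x * gp 1 q x) = (LINT x|lborel. \<psi> x * gp 1 q x)" .
  qed
  have pair: "(LINT x|lborel. u x * gp 1 q x) = (LINT x|lborel. \<psi> x * gp 1 q x)" for q
    by (rule integral_cong_AE) (use ae0 in auto)
  \<comment> \<open>Pairings against Gaussian polynomials determine the weak derivatives, so
    equality of u and \<psi> carries over to them.\<close>
  have ae1: "AE x in lborel. u1 x = \<psi>1 x"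
  proof (rule AE_eq_if_gp_pairings_eq[OF zero_less_one Lu(2) L(2)])
    show "(LINT x|lborel. u1 x * gp 1 p x) = (LINT x|lborel. \<psi>1 x * gp 1 p x)" for p
      using weak_deriv1_gp_test[OF zero_less_one wu(1) Lu(1,2), of p]
        weak_deriv1_gp_test[OF zero_less_one w(1) L(1,2), of p] pair by simp
  qed
  have ae2: "AE x in lborel. u2 x = \<psi>2 x"
  proof (rule AE_eq_if_gp_pairings_eq[OF zero_less_one Lu(3) L(3)])
    show "(LINT x|lborel. u2 x * gp 1 p x) = (LINT x|lborel. \<psi>2 x * gp 1 p x)" for p
      using weak_deriv2_gp_test[OF zero_less_one wu(2) Lu(1,3), of p]
        weak_deriv2_gp_test[OF zero_less_one w(2) L(1,3), of p] pair by simp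
  qed
  have "graph_lim 1 P \<psi> \<psi>1 \<psi>2"
    unfolding graph_lim_def
  proof (intro conjI)
    note U = u(1)[unfolded graph_lim_def]
    show "L2_lim (\<lambda>n. gp 1 (P n)) \<psi>" by (rule L2_lim_AE_cong[OF _ _ ae0]) (use U in auto)
    show "L2_lim (\<lambda>n. gp 1 (gp_D 1 (P n))) \<psi>1" by (rule L2_lim_AE_cong[OF _ _ ae1]) (use U in auto)
    show "L2_lim (\<lambda>n. gp 1 (gp_D 1 (gp_D 1 (P n)))) \<psi>2" by (rule L2_lim_AE_cong[OF _ _ ae2]) (use U in auto)
    show "L2_lim (\<lambda>n. gp 1 (pCons 0 (pCons 0 (P n)))) (\<lambda>x. complex_of_real (x\<^sup>2) * \<psi> x)"
      by (rule L2_lim_AE_cong[of _ "\<lambda>x. complex_of_real (x\<^sup>2) * u x"]) (use U ae0 in auto)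
    show "L2_lim (\<lambda>n. gp 1 (pCons 0 (gp_D 1 (P n)))) (\<lambda>x. complex_of_real x * \<psi>1 x)"
      by (rule L2_lim_AE_cong[of _ "\<lambda>x. complex_of_real x * u1 x"]) (use U ae1 in auto)
  qed
  then show ?thesis by (rule that)
qed

section \<open>Accretivity and the resolvent bound on the whole domain\<close>

text \<open>Even \<open>L2 h\<close> needs \<open>gp_core\<close>: the graph \<open>H_op\<close>
  contains the term x \<psi>1 without requiring it to be square integrable.\<close>

lemma H_op_accretive:
  assumes "H_op \<gamma> \<psi> h"
  shows "L2 \<psi>" "L2 h" "Re (l2_inner h \<psi>) \<ge> 0"
proof -
  from assms have D: "L2 \<psi>" "L2 (\<lambda>x. complex_of_real (x\<^sup>2) * \<psi> x)"
    by (auto simp: H_op_def dom_D_def)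
  from assms obtain \<psi>1 \<psi>2 where w: "L2 \<psi>1" "L2 \<psi>2" "weak_deriv1 \<psi> \<psi>1" "weak_deriv2 \<psi> \<psi>2"
    and h: "h = osc \<gamma> \<psi> \<psi>1 \<psi>2"
    unfolding H_op_def osc_def[abs_def] by blast
  obtain P where P: "graph_lim 1 P \<psi> \<psi>1 \<psi>2"
    using gp_core[OF D(1) w(1,2) D(2) w(3,4)] .
  show "L2 \<psi>" by (rule D(1))
  show "L2 h" using graph_lim_osc[OF P, of \<gamma>] by (simp add: h L2_lim_def)
  show "Re (l2_inner h \<psi>) \<ge> 0"
    unfolding l2_inner_def h by (rule graph_lim_accretive[OF zero_less_one P])
qed

text \<open>Pairing the equation with \<psi> and using accretivity gives |Re z| ||\<psi>||^2 \<le>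
  Re <f, \<psi>> \<le> ||f|| ||\<psi>||; then divide by ||\<psi>|| unless it is 0.\<close>

lemma H_op_resolvent_bound:
  assumes H: "H_op \<gamma> \<psi> h" and z: "Re z < 0" and f: "L2 f" and eq: "AE x in lborel. h x - z * \<psi> x = f x"
  shows "l2_norm \<psi> \<le> l2_norm f / \<bar>Re z\<bar>"
proof -
  note A = H_op_accretive[OF H]
  note [measurable] = L2_measurable[OF A(1)] L2_measurable[OF A(2)] L2_measurable[OF f]
  have [simp]: "l2_norm g = sqrt (sqn g)" for g by (simp add: l2_norm_def sqn_def)
  have uu: "(LINT x|lborel. \<psi> x * cnj (\<psi> x)) = of_real (sqn \<psi>)"
    unfolding sqn_def integral_complex_of_real[symmetric] by (simp only: complex_norm_square)
  have "(LINT x|lborel. f x * cnj (\<psi> x)) = (LINT x|lborel. (h x - z * \<psi> x) * cnj (\<psi> x))"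
    by (rule integral_cong_AE) (use eq L2_measurable[OF L2_cnj[OF A(1)]] in auto)
  also have "\<dots> = (LINT x|lborel. h x * cnj (\<psi> x)) - z * (LINT x|lborel. \<psi> x * cnj (\<psi> x))"
    using A by (simp add: left_diff_distrib mult.assoc L2_mult_integrable L2_cnj)
  finally have "\<bar>Re z\<bar> * sqn \<psi> \<le> Re (LINT x|lborel. f x * cnj (\<psi> x))"
    unfolding uu using A(3) z by (simp add: l2_inner_def)
  also have "\<dots> \<le> cmod (LINT x|lborel. f x * cnj (\<psi> x))" by (rule complex_Re_le_cmod)
  also have "\<dots> \<le> sqrt (sqn f) * sqrt (sqn (\<lambda>x. cnj (\<psi> x)))"
    by (intro L2_Cauchy_Schwarz f L2_cnj A)
  also have "sqn (\<lambda>x. cnj (\<psi> x)) = sqn \<psi>" by (simp add: sqn_def)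
  finally have le: "(\<bar>Re z\<bar> * sqrt (sqn \<psi>)) * sqrt (sqn \<psi>) \<le> sqrt (sqn f) * sqrt (sqn \<psi>)"
    by (simp add: mult.assoc sqn_nonneg)
  have "\<bar>Re z\<bar> * sqrt (sqn \<psi>) \<le> sqrt (sqn f)"
  proof (cases "sqn \<psi> = 0")
    case False
    then have "0 < sqrt (sqn \<psi>)" using sqn_nonneg[of \<psi>] by simp
    with le show ?thesis by (rule mult_right_le_imp_le)
  qed (simp add: sqn_nonneg)
  then show ?thesis using z by (simp add: field_simps)
qed

theorem theorem2:
  fixes \<gamma> :: real
  assumes "\<gamma> \<noteq> 0" and "\<bar>\<gamma>\<bar> \<le> 1"
  shows "m_accretive (H_op \<gamma>)"
  unfolding m_accretive_def
proof (intro conjI allI impI)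
  fix \<psi> h assume "H_op \<gamma> \<psi> h \<and> l2_norm \<psi> = 1"
  then show "Re (l2_inner h \<psi>) \<ge> 0" using H_op_accretive(3) by blast
next
  fix z :: complex and \<psi> h
  assume z: "Re z < 0" and H: "H_op \<gamma> \<psi> h \<and> (AE x in lborel. h x - z * \<psi> x = 0)"
  have L: "L2 \<psi>" using H H_op_accretive(1) by blast
  have "L2 (\<lambda>x. 0)" using L2_scale[OF L, of 0] by simp
  \<comment> \<open>Injectivity is the resolvent bound for the right-hand side 0.\<close>
  then have "l2_norm \<psi> \<le> l2_norm (\<lambda>x. 0) / \<bar>Re z\<bar>"
    using H_op_resolvent_bound[of \<gamma> \<psi> h z] H z by blast
  then have "sqn \<psi> = 0"
    using sqn_nonneg[of \<psi>] unfolding l2_norm_def sqn_def by (simp add: order_antisym)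
  then show "AE x in lborel. \<psi> x = 0" using sqn_eq_0_iff[OF L] by simp
next
  fix z :: complex and f assume z: "Re z < 0" and f: "L2 f"
  define c where "c = \<gamma> + sqrt (1 + \<gamma>\<^sup>2)"
  \<comment> \<open>Strictness makes c positive for either sign of \<gamma>, as needed for the
    Gaussian to decay.\<close>
  have "\<bar>\<gamma>\<bar> < sqrt (1 + \<gamma>\<^sup>2)" by (rule real_less_rsqrt) simp
  then have c0: "c > 0" by (simp add: c_def)
  have c2: "c\<^sup>2 = 1 + 2 * c * \<gamma>"
    by (simp add: c_def power2_sum power2_eq_square[of \<gamma>] algebra_simps)
  obtain P u u1 u2 where u: "graph_lim c P u u1 u2" "AE x in lborel. osc \<gamma> u u1 u2 x - z * u x = f x"
    using resolvent_solution[OF c0 c2 assms(2) z f] .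
  have "H_op \<gamma> u (osc \<gamma> u u1 u2)"
    using graph_lim_L2[OF u(1)] graph_lim_weak_deriv[OF c0 u(1)]
    unfolding H_op_def dom_D_def osc_def[abs_def] by blast
  then show "\<exists>\<psi> h. H_op \<gamma> \<psi> h \<and> (AE x in lborel. h x - z * \<psi> x = f x)"
    using u(2) by blast
next
  fix z :: complex and f \<psi> h
  assume "Re z < 0" "L2 f" "H_op \<gamma> \<psi> h \<and> (AE x in lborel. h x - z * \<psi> x = f x)"
  then show "l2_norm \<psi> \<le> l2_norm f / \<bar>Re z\<bar>"
    using H_op_resolvent_bound by blast
qed

end
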